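(* Let $G\colon\mathbf{Cat_1}\to\mathbf{Set}$ be the forgetful functor sending a small categorder to its set of objects and a functorder to its object function. Then $G$, together with the natural transformation $\sigma\colon\mathcal{P}_0\circ G\to G\circ\mathcal{P}_1$ whose component at $\mathscr{C}$ is the identity $\mathcal{P}_0(\mathrm{ob}\,\mathscr{C})=\mathrm{ob}(\mathcal{P}_1\mathscr{C})$, is a functor of monads from the power categorder monad $\mathcal{P}_1$ on $\mathbf{Cat_1}$ to the power set monad $\mathcal{P}_0$ on $\mathbf{Set}$, that is, $G\eta=\sigma\circ\eta G$ and $\sigma\circ\mu G=G\mu\circ\sigma\mathcal{P}_1\circ\mathcal{P}_0\sigma$; moreover $\sigma$ is a natural isomorphism.
   Context: **Functor of monads.** Given a monad $(S,\mu,\eta)$ on a category $\mathbf{C}$ and a monad $(T,\mu,\eta)$ on a category $\mathbf{D}$, a functor of monads is a functor $F\colon\mathbf{D}\to\mathbf{C}$ together with a natural transformation $\sigma\colon S\circ F\to F\circ T$ satisfying $F\eta=\sigma\circ\eta F$ and $\sigma\circ\mu F=F\mu\circ\sigma T\circ S\sigma$. **Power set monad.** $\mathcal{P}_0\colon\mathbf{Set}\to\mathbf{Set}$ sends a set to its power set and a function to its direct image function; its unit is $s\mapsto\{s\}$ and its multiplication is given by unions. **Categorders and functorders.** An ordering is a partial order. A categorder is a category $\mathscr{C}$ with an ordering on each hom set such that for $c_1,c_2\colon C\to C'$ and $c_1',c_2'\colon C'\to C''$, $c_1\le c_2$ and $c_1'\le c_2'$ imply $c_1'\circ c_1\le c_2'\circ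 c_2$. A functorder $F\colon\mathscr{C}\to\mathscr{D}$ between categorders consists of a function $F\colon\mathrm{ob}\,\mathscr{C}\to\mathrm{ob}\,\mathscr{D}$ and functions $F\colon\mathscr{C}(C,C')\to\mathscr{D}(FC,FC')$ that are monotone and satisfy $F(\mathrm{id}_C)\le\mathrm{id}_{FC}$ and $F(c'\circ c)\le Fc'\circ Fc$. $\mathbf{Cat_1}$ is the category of small categorders and functorders. **Power categorder monad.** For a small categorder $\mathscr{C}$, order $\mathrm{mor}\,\mathscr{C}$ by the orderings of the hom sets (morphisms in different hom sets are incomparable), and write ${\downarrow}A$ for the down closure of $A\subseteq\mathrm{mor}\,\mathscr{C}$. The categorder $\mathcal{P}_1\mathscr{C}$ has as objects all subsets $\mathcal{C}\subseteq\mathrm{ob}\,\mathscr{C}$; its morphisms $\mathcal{C}\to\mathcal{C}'$ are the down closed subsets of $\bigcup_{C\in\mathcal{C},C'\in\mathcal{C}'}\mathscr{C}(C,C')$, ordered by inclusion (the same set of morphisms occurring in different hom sets gives different morphisms); $\mathrm{id}_{\mathcal{C}}={\downarrow}\{\mathrm{id}_C\mid C\in\mathcal{C}\}$; and $\mathbf{c}'\circ\mathbf{c}={\downarrow}\{c'\circ c\mid c\in\mathbf{c},\,c'\in\mathbf{c}',\ c'\circ c\text{ defined}\}$. For a functorder $F$, $\mathcal{P}_1F=F_{\to}$ is given by $F_{\to}(\mathcal{C})=\{FC\mid C\in\mathcal{C}\}$ and $F_{\to}(\mathbf{c})={\downarrow}\{Fc\mid c\in\mathbf{c}\}$. The unit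 $\eta_{\mathscr{C}}$ is $C\mapsto\{C\}$, $c\mapsto{\downarrow}\{c\}$, and the multiplication $\mu_{\mathscr{C}}\colon\mathcal{P}_1^2\mathscr{C}\to\mathcal{P}_1\mathscr{C}$ is given by unions, on objects and on morphisms. These make $\mathcal{P}_1$ a monad on $\mathbf{Cat_1}$. *)

theory Defs
  imports "HOL-Library.FuncSet" "HOL-Library.Nat_Bijection"
begin

section \<open>Small sets\<close>

text \<open>
  HOL has no type of all small sets, so the size distinction is made relative to an arbitrary
  Grothendieck universe: a type whose elements code sets of elements of the same type, closed under
  subsets, pairs, power sets and unions of families indexed by a member. A set is small if
  it has a code. Neither foundation nor infinity is required, so the hereditarily finite
  sets are a universe as well.
\<close>

class universe =
  fixes elts :: "'a \<Rightarrow> 'a set"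
  assumes elts_inject: "elts x = elts y \<Longrightarrow> x = y"
    and subset_in_range: "A \<subseteq> elts x \<Longrightarrow> A \<in> range elts"
    and pair_in_range: "{x, y} \<in> range elts"
    and power_in_range: "{y. elts y \<subseteq> elts x} \<in> range elts"
    and union_in_range: "(\<Union>i\<in>elts x. elts (f i)) \<in> range elts"

lemma universe_hereditarily_finite: "class.universe set_decode"
proof
  have range: "A \<in> range set_decode" if "finite A" for A
    using set_encode_inverse[OF that] by (metis rangeI)
  have fin: "finite {y. set_decode y \<subseteq> set_decode x}" for x
  proof (rule finite_subset)
    show "{y. set_decode y \<subseteq> set_decode x} \<subseteq> set_encode ` Pow (set_decode x)"
      by (metis (no_types, lifting) PowI image_eqI mem_Collect_eq set_decode_inverse subsetI)
  qed simp
  fix A :: "nat set" and f :: "nat \<Rightarrow> nat" and x y :: nat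
  show "x = y" if "set_decode x = set_decode y"
    using that by (metis set_decode_inverse)
  show "A \<in> range set_decode" if "A \<subseteq> set_decode x"
    using that by (meson range finite_subset finite_set_decode)
  show "{x, y} \<in> range set_decode"
    by (rule range) simp
  show "{y. set_decode y \<subseteq> set_decode x} \<in> range set_decode"
    by (rule range) (rule fin)
  show "(\<Union>i\<in>set_decode x. set_decode (f i)) \<in> range set_decode"
    by (rule range) simp
qed

definition small :: "'v::universe set \<Rightarrow> bool"
  where "small A \<longleftrightarrow> A \<in> range elts"

definition vset :: "'v::universe set \<Rightarrow> 'v"
  where "vset A = (THE x. elts x = A)"

definition vPow :: "'v::universe set \<Rightarrow> 'v set"
  where "vPow A = {x. elts x \<subseteq> A}"

definition opair :: "'v::universe \<Rightarrow> 'v \<Rightarrow> 'v"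
  where "opair x y = vset {vset {x}, vset {x, y}}"

lemma vset_elts [simp]: "vset (elts x) = x"
  unfolding vset_def by (rule the_equality) (auto intro: elts_inject)

lemma elts_vset [simp]: "small A \<Longrightarrow> elts (vset A) = A"
  by (auto simp: small_def)

lemma small_pair [simp]: "small {x, y}" "small {x}"
  unfolding small_def using pair_in_range[of x y] pair_in_range[of x x] by simp_all

lemma vset_inject: "small A \<Longrightarrow> small B \<Longrightarrow> vset A = vset B \<longleftrightarrow> A = B"
  by (metis elts_vset)

lemma opair_inject [simp]: "opair x y = opair x' y' \<longleftrightarrow> x = x' \<and> y = y'"
  unfolding opair_def by (simp add: vset_inject doubleton_eq_iff) metis

text \<open>Triples code the morphisms of \<open>\<P>\<^sub>1 \<C>\<close>: domain, codomain, underlying set of morphisms.\<close>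

definition triple :: "'v::universe \<Rightarrow> 'v \<Rightarrow> 'v \<Rightarrow> 'v"
  where "triple x y a = opair x (opair y a)"

definition tdom :: "'v::universe \<Rightarrow> 'v"
  where "tdom m = (THE x. \<exists>y a. m = triple x y a)"

definition tcod :: "'v::universe \<Rightarrow> 'v"
  where "tcod m = (THE y. \<exists>x a. m = triple x y a)"

definition tset :: "'v::universe \<Rightarrow> 'v"
  where "tset m = (THE a. \<exists>x y. m = triple x y a)"

lemma triple_sel [simp]:
  "tdom (triple x y a) = x" "tcod (triple x y a) = y" "tset (triple x y a) = a"
  by (auto simp: triple_def tdom_def tcod_def tset_def)


section \<open>Categories, functors, natural transformations\<close>

record ('o, 'm) cat =
  Ob :: "'o set"
  Mor :: "'m set"
  Dom :: "'m \<Rightarrow> 'o"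
  Cod :: "'m \<Rightarrow> 'o"
  Idn :: "'o \<Rightarrow> 'm"
  Comp :: "'m \<Rightarrow> 'm \<Rightarrow> 'm"  \<comment> \<open>\<open>Comp C g f\<close> is \<open>g \<circ> f\<close>\<close>

definition hom :: "('o, 'm, 'x) cat_scheme \<Rightarrow> 'o \<Rightarrow> 'o \<Rightarrow> 'm set"
  where "hom C a b = {f \<in> Mor C. Dom C f = a \<and> Cod C f = b}"

definition category :: "('o, 'm, 'x) cat_scheme \<Rightarrow> bool"
  where "category C \<longleftrightarrow>
    (\<forall>f\<in>Mor C. Dom C f \<in> Ob C \<and> Cod C f \<in> Ob C) \<and>
    (\<forall>a\<in>Ob C. Idn C a \<in> hom C a a) \<and>
    (\<forall>a b c. \<forall>f\<in>hom C a b. \<forall>g\<in>hom C b c. Comp C g f \<in> hom C a c) \<and>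
    (\<forall>a b. \<forall>f\<in>hom C a b. Comp C f (Idn C a) = f \<and> Comp C (Idn C b) f = f) \<and>
    (\<forall>a b c d. \<forall>f\<in>hom C a b. \<forall>g\<in>hom C b c. \<forall>h\<in>hom C c d.
       Comp C h (Comp C g f) = Comp C (Comp C h g) f)"

record ('o1, 'm1, 'o2, 'm2) fmap =
  onOb :: "'o1 \<Rightarrow> 'o2"
  onMor :: "'m1 \<Rightarrow> 'm2"

definition is_functor ::
  "('o1, 'm1, 'x) cat_scheme \<Rightarrow> ('o2, 'm2, 'y) cat_scheme \<Rightarrow> ('o1, 'm1, 'o2, 'm2) fmap \<Rightarrow> bool"
  where "is_functor C D F \<longleftrightarrow>
    category C \<and> category D \<and>
    (\<forall>a\<in>Ob C. onOb F a \<in> Ob D) \<and>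
    (\<forall>a b. \<forall>f\<in>hom C a b. onMor F f \<in> hom D (onOb F a) (onOb F b)) \<and>
    (\<forall>a\<in>Ob C. onMor F (Idn C a) = Idn D (onOb F a)) \<and>
    (\<forall>a b c. \<forall>f\<in>hom C a b. \<forall>g\<in>hom C b c.
       onMor F (Comp C g f) = Comp D (onMor F g) (onMor F f))"

definition idF :: "('o, 'm, 'o, 'm) fmap"
  where "idF = \<lparr>onOb = (\<lambda>a. a), onMor = (\<lambda>f. f)\<rparr>"

definition compF ::
  "('o2, 'm2, 'o3, 'm3) fmap \<Rightarrow> ('o1, 'm1, 'o2, 'm2) fmap \<Rightarrow> ('o1, 'm1, 'o3, 'm3) fmap"
    (infixr "\<circ>F" 70)
  where "G \<circ>F F = \<lparr>onOb = onOb G \<circ> onOb F, onMor = onMor G \<circ> onMor F\<rparr>"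

definition nat_trans ::
  "('o1, 'm1, 'x) cat_scheme \<Rightarrow> ('o2, 'm2, 'y) cat_scheme \<Rightarrow>
   ('o1, 'm1, 'o2, 'm2) fmap \<Rightarrow> ('o1, 'm1, 'o2, 'm2) fmap \<Rightarrow> ('o1 \<Rightarrow> 'm2) \<Rightarrow> bool"
  where "nat_trans C D F G \<tau> \<longleftrightarrow>
    is_functor C D F \<and> is_functor C D G \<and>
    (\<forall>a\<in>Ob C. \<tau> a \<in> hom D (onOb F a) (onOb G a)) \<and>
    (\<forall>a b. \<forall>f\<in>hom C a b. Comp D (\<tau> b) (onMor F f) = Comp D (onMor G f) (\<tau> a))"

definition iso_mor :: "('o, 'm, 'x) cat_scheme \<Rightarrow> 'm \<Rightarrow> bool"
  where "iso_mor C f \<longleftrightarrow> f \<in> Mor C \<and>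
    (\<exists>g\<in>hom C (Cod C f) (Dom C f).
       Comp C g f = Idn C (Dom C f) \<and> Comp C f g = Idn C (Cod C f))"

definition natural_iso ::
  "('o1, 'm1, 'x) cat_scheme \<Rightarrow> ('o2, 'm2, 'y) cat_scheme \<Rightarrow>
   ('o1, 'm1, 'o2, 'm2) fmap \<Rightarrow> ('o1, 'm1, 'o2, 'm2) fmap \<Rightarrow> ('o1 \<Rightarrow> 'm2) \<Rightarrow> bool"
  where "natural_iso C D F G \<tau> \<longleftrightarrow> nat_trans C D F G \<tau> \<and> (\<forall>a\<in>Ob C. iso_mor D (\<tau> a))"

definition vcomp ::
  "('o2, 'm2, 'y) cat_scheme \<Rightarrow> ('o1 \<Rightarrow> 'm2) \<Rightarrow> ('o1 \<Rightarrow> 'm2) \<Rightarrow> 'o1 \<Rightarrow> 'm2"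
  where "vcomp D \<tau> \<rho> = (\<lambda>a. Comp D (\<tau> a) (\<rho> a))"

text \<open>The whiskerings \<open>F\<tau>\<close> and \<open>\<tau>F\<close>.\<close>

definition whisker_left ::
  "('o2, 'm2, 'o3, 'm3) fmap \<Rightarrow> ('o1 \<Rightarrow> 'm2) \<Rightarrow> 'o1 \<Rightarrow> 'm3" (infixr "\<cdot>L" 75)
  where "F \<cdot>L \<tau> = (\<lambda>a. onMor F (\<tau> a))"

definition whisker_right ::
  "('o2 \<Rightarrow> 'm3) \<Rightarrow> ('o1, 'm1, 'o2, 'm2) fmap \<Rightarrow> 'o1 \<Rightarrow> 'm3" (infixl "\<cdot>R" 75)
  where "\<tau> \<cdot>R F = (\<lambda>a. \<tau> (onOb F a))"


section \<open>Monads and functors of monads\<close>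

record ('o, 'm) monad_data =
  Fun :: "('o, 'm, 'o, 'm) fmap"
  mult :: "'o \<Rightarrow> 'm"
  unit :: "'o \<Rightarrow> 'm"

text \<open>Natural transformations are families indexed by a whole type, of which only the components
  at objects of the source category matter; hence equations between them are restricted to these.\<close>

definition monad :: "('o, 'm, 'x) cat_scheme \<Rightarrow> ('o, 'm) monad_data \<Rightarrow> bool"
  where "monad C T \<longleftrightarrow>
    is_functor C C (Fun T) \<and>
    nat_trans C C idF (Fun T) (unit T) \<and>
    nat_trans C C (Fun T \<circ>F Fun T) (Fun T) (mult T) \<and>
    (\<forall>a\<in>Ob C. vcomp C (mult T) (Fun T \<cdot>L unit T) a = Idn C (onOb (Fun T) a)) \<and>
    (\<forall>a\<in>Ob C. vcomp C (mult T) (unit T \<cdot>R Fun T) a = Idn C (onOb (Fun T) a)) \<and>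
    (\<forall>a\<in>Ob C. vcomp C (mult T) (Fun T \<cdot>L mult T) a = vcomp C (mult T) (mult T \<cdot>R Fun T) a)"

definition functor_of_monads ::
  "('o1, 'm1, 'x) cat_scheme \<Rightarrow> ('o1, 'm1) monad_data \<Rightarrow>
   ('o2, 'm2, 'y) cat_scheme \<Rightarrow> ('o2, 'm2) monad_data \<Rightarrow>
   ('o1, 'm1, 'o2, 'm2) fmap \<Rightarrow> ('o1 \<Rightarrow> 'm2) \<Rightarrow> bool"
  \<comment> \<open>\<open>functor_of_monads D T C S F \<sigma>\<close>: from the monad \<open>T\<close> on \<open>D\<close> to the monad \<open>S\<close> on \<open>C\<close>\<close>
  where "functor_of_monads D T C S F \<sigma> \<longleftrightarrow>
    monad D T \<and> monad C S \<and>
    is_functor D C F \<and>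
    nat_trans D C (Fun S \<circ>F F) (F \<circ>F Fun T) \<sigma> \<and>
    (\<forall>d\<in>Ob D. (F \<cdot>L unit T) d = vcomp C \<sigma> (unit S \<cdot>R F) d) \<and>
    (\<forall>d\<in>Ob D. vcomp C \<sigma> (mult S \<cdot>R F) d =
                vcomp C (F \<cdot>L mult T) (vcomp C (\<sigma> \<cdot>R Fun T) (Fun S \<cdot>L \<sigma>)) d)"


section \<open>The category of small sets and the power set monad\<close>

type_synonym 'v arr = "'v set \<times> ('v \<Rightarrow> 'v) \<times> 'v set"

definition SetCat :: "('v::universe set, 'v arr) cat"
  where "SetCat = \<lparr>
    Ob = {A. small A},
    Mor = {(A, f, B). small A \<and> small B \<and> f \<in> A \<rightarrow>\<^sub>E B},
    Dom = (\<lambda>(A, f, B). A),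
    Cod = (\<lambda>(A, f, B). B),
    Idn = (\<lambda>A. (A, \<lambda>x\<in>A. x, A)),
    Comp = (\<lambda>(B, g, C) (A, f, B'). (A, compose A g f, C))\<rparr>"

text \<open>The elements of the power set \<open>vPow A\<close> are the codes of the subsets of \<open>A\<close>.\<close>

definition P0_fun :: "('v::universe set, 'v arr, 'v set, 'v arr) fmap"
  where "P0_fun = \<lparr>
    onOb = vPow,
    onMor = (\<lambda>(A, f, B). (vPow A, \<lambda>x\<in>vPow A. vset (f ` elts x), vPow B))\<rparr>"

definition P0 :: "('v::universe set, 'v arr) monad_data"
  where "P0 = \<lparr>
    Fun = P0_fun,
    mult = (\<lambda>A. (vPow (vPow A), \<lambda>X\<in>vPow (vPow A). vset (\<Union>x\<in>elts X. elts x), vPow A)),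
    unit = (\<lambda>A. (A, \<lambda>s\<in>A. vset {s}, vPow A))\<rparr>"


section \<open>Categorders and functorders\<close>

text \<open>The orderings of the hom sets are given together as one ordering of the set of all
  morphisms, in which morphisms of different hom sets are incomparable.\<close>

record ('o, 'm) categorder = "('o, 'm) cat" +
  le :: "'m \<Rightarrow> 'm \<Rightarrow> bool"

definition is_categorder :: "('o, 'm) categorder \<Rightarrow> bool"
  where "is_categorder C \<longleftrightarrow>
    category C \<and>
    (\<forall>f g. le C f g \<longrightarrow> f \<in> Mor C \<and> g \<in> Mor C \<and> Dom C f = Dom C g \<and> Cod C f = Cod C g) \<and>
    (\<forall>f\<in>Mor C. le C f f) \<and>
    (\<forall>f g. le C f g \<longrightarrow> le C g f \<longrightarrow> f = g) \<and>
    (\<forall>f g h. le C f g \<longrightarrow> le C g h \<longrightarrow> le C f h) \<and>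
    (\<forall>a b c. \<forall>f1\<in>hom C a b. \<forall>f2\<in>hom C a b. \<forall>g1\<in>hom C b c. \<forall>g2\<in>hom C b c.
       le C f1 f2 \<longrightarrow> le C g1 g2 \<longrightarrow> le C (Comp C g1 f1) (Comp C g2 f2))"

definition is_functorder ::
  "('o1, 'm1) categorder \<Rightarrow> ('o2, 'm2) categorder \<Rightarrow> ('o1, 'm1, 'o2, 'm2) fmap \<Rightarrow> bool"
  where "is_functorder C D F \<longleftrightarrow>
    (\<forall>a\<in>Ob C. onOb F a \<in> Ob D) \<and>
    (\<forall>a b. \<forall>f\<in>hom C a b. onMor F f \<in> hom D (onOb F a) (onOb F b)) \<and>
    (\<forall>f g. le C f g \<longrightarrow> le D (onMor F f) (onMor F g)) \<and>
    (\<forall>a\<in>Ob C. le D (onMor F (Idn C a)) (Idn D (onOb F a))) \<and>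
    (\<forall>a b c. \<forall>f\<in>hom C a b. \<forall>g\<in>hom C b c.
       le D (onMor F (Comp C g f)) (Comp D (onMor F g) (onMor F f)))"

text \<open>The structure maps are made \<open>undefined\<close> outside their domains of definition, so that
  categorders (and, below, functorders) with the same mathematical content are equal in HOL.\<close>

definition small_categorder :: "('v::universe, 'v) categorder \<Rightarrow> bool"
  where "small_categorder C \<longleftrightarrow>
    is_categorder C \<and> small (Ob C) \<and> small (Mor C) \<and>
    Dom C \<in> extensional (Mor C) \<and> Cod C \<in> extensional (Mor C) \<and>
    Idn C \<in> extensional (Ob C) \<and>
    (\<forall>g f. \<not> (f \<in> Mor C \<and> g \<in> Mor C \<and> Cod C f = Dom C g) \<longrightarrow> Comp C g f = undefined)"

type_synonym 'v scat = "('v, 'v) categorder"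
type_synonym 'v fo = "'v scat \<times> ('v, 'v, 'v, 'v) fmap \<times> 'v scat"

definition Cat1 :: "('v::universe scat, 'v fo) cat"
  where "Cat1 = \<lparr>
    Ob = {C. small_categorder C},
    Mor = {(C, F, D). small_categorder C \<and> small_categorder D \<and> is_functorder C D F \<and>
             onOb F \<in> extensional (Ob C) \<and> onMor F \<in> extensional (Mor C)},
    Dom = (\<lambda>(C, F, D). C),
    Cod = (\<lambda>(C, F, D). D),
    Idn = (\<lambda>C. (C, \<lparr>onOb = \<lambda>a\<in>Ob C. a, onMor = \<lambda>f\<in>Mor C. f\<rparr>, C)),
    Comp = (\<lambda>(D, G, E) (C, F, D').
      (C, \<lparr>onOb = compose (Ob C) (onOb G) (onOb F),
           onMor = compose (Mor C) (onMor G) (onMor F)\<rparr>, E))\<rparr>"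


section \<open>The power categorder monad\<close>

definition down :: "('o, 'm) categorder \<Rightarrow> 'm set \<Rightarrow> 'm set"
  where "down C A = {f. \<exists>g\<in>A. le C f g}"

definition P1_Mor :: "'v::universe scat \<Rightarrow> 'v set"
  where "P1_Mor C = {triple X Y a | X Y a.
    X \<in> vPow (Ob C) \<and> Y \<in> vPow (Ob C) \<and>
    elts a \<subseteq> (\<Union>c\<in>elts X. \<Union>c'\<in>elts Y. hom C c c') \<and>
    down C (elts a) \<subseteq> elts a}"

definition P1_cat :: "'v::universe scat \<Rightarrow> 'v scat"
  where "P1_cat C = \<lparr>
    Ob = vPow (Ob C),
    Mor = P1_Mor C,
    Dom = restrict tdom (P1_Mor C),
    Cod = restrict tcod (P1_Mor C),
    Idn = (\<lambda>X\<in>vPow (Ob C). triple X X (vset (down C (Idn C ` elts X)))),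
    Comp = (\<lambda>n m.
      if m \<in> P1_Mor C \<and> n \<in> P1_Mor C \<and> tcod m = tdom n
      then triple (tdom m) (tcod n)
             (vset (down C {Comp C g f | f g.
                f \<in> elts (tset m) \<and> g \<in> elts (tset n) \<and> Cod C f = Dom C g}))
      else undefined),
    le = (\<lambda>m n. m \<in> P1_Mor C \<and> n \<in> P1_Mor C \<and> tdom m = tdom n \<and> tcod m = tcod n \<and>
      elts (tset m) \<subseteq> elts (tset n))\<rparr>"

definition P1_fun :: "('v::universe scat, 'v fo, 'v scat, 'v fo) fmap"
  where "P1_fun = \<lparr>
    onOb = P1_cat,
    onMor = (\<lambda>(C, F, D). (P1_cat C,
      \<lparr>onOb = (\<lambda>X\<in>Ob (P1_cat C). vset (onOb F ` elts X)),
       onMor = (\<lambda>m\<in>Mor (P1_cat C).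
         triple (vset (onOb F ` elts (tdom m))) (vset (onOb F ` elts (tcod m)))
           (vset (down D (onMor F ` elts (tset m)))))\<rparr>,
      P1_cat D))\<rparr>"

definition P1 :: "('v::universe scat, 'v fo) monad_data"
  where "P1 = \<lparr>
    Fun = P1_fun,
    mult = (\<lambda>C. (P1_cat (P1_cat C),
      \<lparr>onOb = (\<lambda>X\<in>Ob (P1_cat (P1_cat C)). vset (\<Union>x\<in>elts X. elts x)),
       onMor = (\<lambda>m\<in>Mor (P1_cat (P1_cat C)).
         triple (vset (\<Union>x\<in>elts (tdom m). elts x)) (vset (\<Union>y\<in>elts (tcod m). elts y))
           (vset (\<Union>n\<in>elts (tset m). elts (tset n))))\<rparr>,
      P1_cat C)),
    unit = (\<lambda>C. (C,
      \<lparr>onOb = (\<lambda>c\<in>Ob C. vset {c}),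
       onMor = (\<lambda>f\<in>Mor C.
         triple (vset {Dom C f}) (vset {Cod C f}) (vset (down C {f})))\<rparr>,
      P1_cat C))\<rparr>"


section \<open>The forgetful functor\<close>

definition forget :: "('v::universe scat, 'v fo, 'v set, 'v arr) fmap"
  where "forget = \<lparr>onOb = Ob, onMor = (\<lambda>(C, F, D). (Ob C, onOb F, Ob D))\<rparr>"

definition sigma :: "'v::universe scat \<Rightarrow> 'v arr"
  where "sigma C = Idn SetCat (vPow (Ob C))"

end

theory Submission
  imports Defs
begin

text \<open>On objects \<open>\<P>\<^sub>1\<close> is the power set monad, and both equations for the forgetful functor only concern
  object functions, so they hold because \<open>\<sigma>\<close> consists of identities. The substance is that \<open>\<P>\<^sub>1\<close> is a
  monad: every set of morphisms that occurs is the down closure of a set of images or composites,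
  and by monotonicity inner down closures are absorbed by the outermost one.\<close>

section \<open>Small sets\<close>

text \<open>Two features of the encoding shape the work. Objects and morphisms of
  \<open>P1_cat C\<close> are codes, so a set must be known to be small before
  \<open>elts (vset A) = A\<close> applies; for sets of morphisms this costs nothing, as they all
  lie in the small set \<open>Mor C\<close>. And maps are undefined outside their carriers, so that
  equality of arrows is equality in HOL, at the price of checking at each composition that a value
  lies in the carrier on which the next map is defined. Functorders are lax and the order of
  \<open>P1_cat C\<close> is inclusion, so images, units and unions need only satisfy inclusions in
  order to be functorders. For the multiplication and composition no more is true in general.
  Functoriality of \<open>P1_fun\<close>, naturality and the monad laws are in contrast equations,
  and they hold strictly: functorders are composed pointwise, so the lax inequalities never enter
  there, only monotonicity and the order axioms.\<close>

lemma small_elts [simp]: "small (elts x)"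
  by (simp add: small_def)

lemma small_subset: "small B \<Longrightarrow> A \<subseteq> B \<Longrightarrow> small A"
  unfolding small_def using subset_in_range by blast

text \<open>The union axiom of \<open>universe\<close> speaks of families of codes indexed by the
  elements of a code; \<open>vset\<close> turns a family of small sets into such a family.\<close>

lemma small_UN [simp]:
  fixes F :: "'v::universe \<Rightarrow> 'v set"
  assumes "small A" and "\<And>x. x \<in> A \<Longrightarrow> small (F x)"
  shows "small (\<Union>x\<in>A. F x)"
proof -
  obtain a where a: "A = elts a"
    using assms(1) by (auto simp: small_def)
  have "(\<Union>x\<in>A. F x) = (\<Union>x\<in>elts a. elts (vset (F x)))"
    using assms(2) a by simp
  then show ?thesis
    unfolding small_def using union_in_range[where f = "\<lambda>x. vset (F x)"] by metis
qed

text \<open>Replacement is not among the axioms of \<open>universe\<close>. It follows by writing an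
  image as a union of singletons, which are small by pairing.\<close>

lemma small_image [simp]: "small A \<Longrightarrow> small (f ` A)" for f :: "'v::universe \<Rightarrow> 'v"
  using small_UN[of A "\<lambda>x. {f x}"] by (simp add: UNION_singleton_eq_range)

lemma small_vPow [simp]: "small A \<Longrightarrow> small (vPow A)"
  unfolding vPow_def small_def using power_in_range by fastforce

lemma mem_vPow [simp]: "x \<in> vPow A \<longleftrightarrow> elts x \<subseteq> A"
  by (simp add: vPow_def)

lemma image_restrict_subset: "A \<subseteq> B \<Longrightarrow> restrict f B ` A = f ` A"
  by (auto simp: subset_iff)


section \<open>Small sets as a category and the power set monad\<close>

text \<open>Composability is the equation \<open>Cod C f = Dom C g\<close> instead of membership in
  two hom sets, which suits arrows that carry their domain and codomain explicitly.\<close>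

lemma categoryI:
  assumes "\<And>f. f \<in> Mor C \<Longrightarrow> Dom C f \<in> Ob C \<and> Cod C f \<in> Ob C"
    and "\<And>a. a \<in> Ob C \<Longrightarrow> Idn C a \<in> Mor C \<and> Dom C (Idn C a) = a \<and> Cod C (Idn C a) = a"
    and "\<And>f g. f \<in> Mor C \<Longrightarrow> g \<in> Mor C \<Longrightarrow> Cod C f = Dom C g \<Longrightarrow>
      Comp C g f \<in> Mor C \<and> Dom C (Comp C g f) = Dom C f \<and> Cod C (Comp C g f) = Cod C g"
    and "\<And>f. f \<in> Mor C \<Longrightarrow> Comp C f (Idn C (Dom C f)) = f \<and> Comp C (Idn C (Cod C f)) f = f"
    and "\<And>f g h. f \<in> Mor C \<Longrightarrow> g \<in> Mor C \<Longrightarrow> h \<in> Mor C \<Longrightarrow> Cod C f = Dom C g \<Longrightarrow>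
      Cod C g = Dom C h \<Longrightarrow> Comp C h (Comp C g f) = Comp C (Comp C h g) f"
  shows "category C"
  using assms unfolding category_def hom_def by auto

lemma SetCat_simps [simp]:
  "Ob SetCat = {A. small A}"
  "(A, f, B) \<in> Mor SetCat \<longleftrightarrow> small A \<and> small B \<and> f \<in> A \<rightarrow>\<^sub>E B"
  "Dom SetCat (A, f, B) = A"
  "Cod SetCat (A, f, B) = B"
  "Idn SetCat A = (A, \<lambda>x\<in>A. x, A)"
  "Comp SetCat (B', g, D) (A, f, B) = (A, compose A g f, D)"
  by (simp_all add: SetCat_def)

lemma hom_SetCat:
  "m \<in> hom SetCat A B \<longleftrightarrow> (\<exists>f. m = (A, f, B) \<and> small A \<and> small B \<and> f \<in> A \<rightarrow>\<^sub>E B)"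
  by (cases m) (auto simp: hom_def)

lemma compose_in_PiE: "f \<in> A \<rightarrow>\<^sub>E B \<Longrightarrow> g \<in> B \<rightarrow>\<^sub>E D \<Longrightarrow> compose A g f \<in> A \<rightarrow>\<^sub>E D"
  by (auto simp: compose_def)

lemma compose_restrict_id_right: "f \<in> extensional A \<Longrightarrow> compose A f (\<lambda>x\<in>A. x) = f"
  by (rule extensionalityI[of _ A]) (auto simp: compose_def)

lemma compose_restrict_id_left:
  "f \<in> extensional A \<Longrightarrow> f ` A \<subseteq> B \<Longrightarrow> compose A (\<lambda>x\<in>B. x) f = f"
  by (rule extensionalityI[of _ A]) (auto simp: compose_def)

lemma compose_cong:
  "(\<And>x. x \<in> A \<Longrightarrow> g (f x) = g' (f' x)) \<Longrightarrow> compose A g f = compose A g' f'"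
  by (auto simp: compose_def)

lemma Mor_SetCatE:
  assumes "m \<in> Mor SetCat"
  obtains A f B where "m = (A, f, B)" "small A" "small B" "f \<in> A \<rightarrow>\<^sub>E B"
  using assms by (cases m) simp

lemma category_SetCat: "category (SetCat :: ('v::universe set, 'v arr) cat)"
proof (rule categoryI)
  fix m :: "'v arr"
  assume "m \<in> Mor SetCat"
  then obtain A f B where m: "m = (A, f, B)" "small A" "small B" "f \<in> A \<rightarrow>\<^sub>E B"
    by (rule Mor_SetCatE)
  then have "f \<in> extensional A" "f ` A \<subseteq> B"
    by (auto simp: PiE_def)
  with m show "Dom SetCat m \<in> Ob SetCat \<and> Cod SetCat m \<in> Ob SetCat"
    "Comp SetCat m (Idn SetCat (Dom SetCat m)) = m \<and>
      Comp SetCat (Idn SetCat (Cod SetCat m)) m = m"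
    by (simp_all add: compose_restrict_id_right compose_restrict_id_left)
next
  fix m n k :: "'v arr"
  assume "m \<in> Mor SetCat" "n \<in> Mor SetCat"
  then obtain A f B B' g D where mn: "m = (A, f, B)" "n = (B', g, D)" "small A" "small D"
    and f: "f \<in> A \<rightarrow>\<^sub>E B" and g: "g \<in> B' \<rightarrow>\<^sub>E D"
    by (metis Mor_SetCatE)
  assume "Cod SetCat m = Dom SetCat n"
  with mn have B': "B' = B"
    by simp
  show "Comp SetCat n m \<in> Mor SetCat \<and> Dom SetCat (Comp SetCat n m) = Dom SetCat m \<and>
      Cod SetCat (Comp SetCat n m) = Cod SetCat n"
    using compose_in_PiE[OF f g[unfolded B']] mn by (simp add: B')
  assume "k \<in> Mor SetCat" "Cod SetCat n = Dom SetCat k"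
  then obtain h E where "k = (D, h, E)"
    using mn by (cases k) simp
  with mn B' f show "Comp SetCat k (Comp SetCat n m) = Comp SetCat (Comp SetCat k n) m"
    by (auto simp: compose_def intro!: restrict_ext)
qed simp_all

section \<open>Functors, natural transformations and the power set monad\<close>

lemma functorI:
  assumes "category C" "category D"
    and "\<And>a. a \<in> Ob C \<Longrightarrow> onOb F a \<in> Ob D"
    and "\<And>a b f. f \<in> hom C a b \<Longrightarrow> onMor F f \<in> hom D (onOb F a) (onOb F b)"
    and "\<And>a. a \<in> Ob C \<Longrightarrow> onMor F (Idn C a) = Idn D (onOb F a)"
    and "\<And>a b c f g. f \<in> hom C a b \<Longrightarrow> g \<in> hom C b c \<Longrightarrow>
      onMor F (Comp C g f) = Comp D (onMor F g) (onMor F f)"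
  shows "is_functor C D F"
  using assms unfolding is_functor_def by blast

lemma idF_simps [simp]: "onOb idF a = a" "onMor idF f = f"
  by (simp_all add: idF_def)

lemma compF_simps [simp]:
  "onOb (G \<circ>F F) a = onOb G (onOb F a)" "onMor (G \<circ>F F) f = onMor G (onMor F f)"
  by (simp_all add: compF_def)

lemma functor_idF: "category C \<Longrightarrow> is_functor C C idF"
  by (rule functorI) auto

lemma functor_compF:
  assumes "is_functor C D F" "is_functor D E G"
  shows "is_functor C E (G \<circ>F F)"
proof (rule functorI)
  fix a b c f g assume "f \<in> hom C a b" "g \<in> hom C b c"
  with assms show "onMor (G \<circ>F F) (Comp C g f) = Comp E (onMor (G \<circ>F F) g) (onMor (G \<circ>F F) f)"
    unfolding is_functor_def by simp metis
qed (use assms in \<open>auto simp: is_functor_def\<close>)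

lemma nat_transI:
  assumes "is_functor C D F" "is_functor C D G"
    and "\<And>a. a \<in> Ob C \<Longrightarrow> \<tau> a \<in> hom D (onOb F a) (onOb G a)"
    and "\<And>a b f. f \<in> hom C a b \<Longrightarrow> Comp D (\<tau> b) (onMor F f) = Comp D (onMor G f) (\<tau> a)"
  shows "nat_trans C D F G \<tau>"
  using assms unfolding nat_trans_def by blast

lemma P0_simps [simp]:
  "Fun P0 = P0_fun"
  "onOb P0_fun A = vPow A"
  "onMor P0_fun (A, f, B) = (vPow A, \<lambda>x\<in>vPow A. vset (f ` elts x), vPow B)"
  "mult P0 A = (vPow (vPow A), \<lambda>X\<in>vPow (vPow A). vset (\<Union>x\<in>elts X. elts x), vPow A)"
  "unit P0 A = (A, \<lambda>s\<in>A. vset {s}, vPow A)"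
  by (simp_all add: P0_def P0_fun_def)

lemma PiE_image_subset: "f \<in> A \<rightarrow>\<^sub>E B \<Longrightarrow> X \<subseteq> A \<Longrightarrow> f ` X \<subseteq> B"
  by blast

text \<open>With the default congruence rules for images and unions the simplifier unfolds
  \<open>restrict f B ` A\<close> to a case distinction before \<open>image_restrict_subset\<close> applies; hence
  the deletions of these rules.\<close>

lemma functor_P0: "is_functor (SetCat :: ('v::universe set, 'v arr) cat) SetCat P0_fun"
proof (rule functorI)
  fix A :: "'v set" assume "A \<in> Ob SetCat"
  then show "onMor P0_fun (Idn SetCat A) = Idn SetCat (onOb P0_fun A)"
    by (auto intro!: restrict_ext simp: image_restrict_subset cong del: image_cong_simp)
next
  fix A B C :: "'v set" and m n
  assume "m \<in> hom SetCat A B" "n \<in> hom SetCat B C"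
  then obtain f g where mn: "m = (A, f, B)" "n = (B, g, C)" "small A" "small B"
    and f: "f \<in> A \<rightarrow>\<^sub>E B"
    unfolding hom_SetCat by blast
  \<comment> \<open>The second conjunct puts the inner image into \<open>vPow B\<close>, outside of
    which the outer direct image function is undefined.\<close>
  have "vset (compose A g f ` elts x) = vset (g ` elts (vset (f ` elts x))) \<and>
      elts (vset (f ` elts x)) \<subseteq> B" if "elts x \<subseteq> A" for x
    using that PiE_image_subset[OF f that]
    by (simp add: compose_def image_restrict_subset image_image cong del: image_cong_simp)
  with mn show "onMor P0_fun (Comp SetCat n m) = Comp SetCat (onMor P0_fun n) (onMor P0_fun m)"
    by (simp add: compose_def restrict_def fun_eq_iff)
next
  fix A B :: "'v set" and m
  assume "m \<in> hom SetCat A B"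
  then obtain f where m: "m = (A, f, B)" "small A" "small B" and f: "f \<in> A \<rightarrow>\<^sub>E B"
    unfolding hom_SetCat by blast
  then show "onMor P0_fun m \<in> hom SetCat (onOb P0_fun A) (onOb P0_fun B)"
    using PiE_image_subset[OF f] by (simp add: hom_SetCat m)
qed (simp_all add: category_SetCat)

lemma monad_P0: "monad (SetCat :: ('v::universe set, 'v arr) cat) P0" (is "monad ?S ?P")
  unfolding monad_def
proof (intro conjI ballI)
  show "is_functor ?S ?S (Fun ?P)"
    by (simp add: functor_P0)
  show "nat_trans ?S ?S idF (Fun ?P) (unit ?P)"
  proof (rule nat_transI)
    fix A B :: "'v set" and m
    assume "m \<in> hom ?S A B"
    then show "Comp ?S (unit ?P B) (onMor idF m) = Comp ?S (onMor (Fun ?P) m) (unit ?P A)"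
      by (force simp: hom_SetCat intro!: compose_cong)
  qed (auto simp: functor_P0 functor_idF category_SetCat hom_SetCat)
  show "nat_trans ?S ?S (Fun ?P \<circ>F Fun ?P) (Fun ?P) (mult ?P)"
  proof (rule nat_transI)
    fix A B :: "'v set" and m
    assume "m \<in> hom ?S A B"
    then obtain f where m: "m = (A, f, B)" "f \<in> A \<rightarrow>\<^sub>E B" "small A" "small B"
      by (auto simp: hom_SetCat)
    let ?F = "\<lambda>x\<in>vPow A. vset (f ` elts x)"
    \<comment> \<open>This is the content of naturality: direct images commute with unions. The two
      facts after it only place values in the domains of the restricted maps.\<close>
    have "(\<Union>y\<in>elts (vset (?F ` elts X)). elts y) = f ` (\<Union>x\<in>elts X. elts x)"
      if "elts X \<subseteq> vPow A" for X
      by (simp only: image_restrict_subset[OF that]) (simp add: image_UN)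
    moreover have "?F ` elts X \<subseteq> vPow B" if "elts X \<subseteq> vPow A" for X
      unfolding image_restrict_subset[OF that] using that m(2) by fastforce
    moreover have "(\<Union>x\<in>elts X. elts x) \<subseteq> A" if "elts X \<subseteq> vPow A" for X
      using that by fastforce
    ultimately have "compose (vPow (vPow A)) (\<lambda>X\<in>vPow (vPow B). vset (\<Union>x\<in>elts X. elts x))
        (\<lambda>X\<in>vPow (vPow A). vset (?F ` elts X)) =
      compose (vPow (vPow A)) ?F (\<lambda>X\<in>vPow (vPow A). vset (\<Union>x\<in>elts X. elts x))"
      by (intro compose_cong) (simp cong del: image_cong_simp SUP_cong_simp)
    then show "Comp ?S (mult ?P B) (onMor (Fun ?P \<circ>F Fun ?P) m)
        = Comp ?S (onMor (Fun ?P) m) (mult ?P A)"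
      by (simp only: m P0_simps compF_simps SetCat_simps)
  qed (simp_all add: functor_P0 functor_compF[OF functor_P0 functor_P0] hom_SetCat, fastforce)
next
  fix A :: "'v set" assume A: "A \<in> Ob ?S"
  show "vcomp ?S (mult ?P) (Fun ?P \<cdot>L unit ?P) A = Idn ?S (onOb (Fun ?P) A)"
    using A by (auto simp: vcomp_def whisker_left_def compose_def image_restrict_subset
        intro!: restrict_ext cong del: image_cong_simp SUP_cong_simp) blast
  show "vcomp ?S (mult ?P) (unit ?P \<cdot>R Fun ?P) A = Idn ?S (onOb (Fun ?P) A)"
    using A by (auto simp: vcomp_def whisker_right_def compose_def intro!: restrict_ext)
  \<comment> \<open>The middle conjunct is associativity of unions; the outer two say that both ways
    of flattening once end in the domain of the remaining union map.\<close>
  have "elts (vset ((\<lambda>Y\<in>vPow (vPow A). vset (\<Union>y\<in>elts Y. elts y)) ` elts X)) \<subseteq> vPow A \<and>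
      (\<Union>x\<in>(\<lambda>Y\<in>vPow (vPow A). vset (\<Union>y\<in>elts Y. elts y)) ` elts X. elts x) =
        (\<Union>x\<in>(\<Union>Y\<in>elts X. elts Y). elts x) \<and> (\<Union>Y\<in>elts X. elts Y) \<subseteq> vPow A"
    if "elts X \<subseteq> vPow (vPow A)" for X
    unfolding image_restrict_subset[OF that] using that by (simp, fastforce)
  then show "vcomp ?S (mult ?P) (Fun ?P \<cdot>L mult ?P) A = vcomp ?S (mult ?P) (mult ?P \<cdot>R Fun ?P) A"
    using A by (auto simp: vcomp_def whisker_left_def whisker_right_def
        intro!: compose_cong cong del: image_cong_simp SUP_cong_simp)
qed


section \<open>Categorders and functorders\<close>

lemma
  assumes "category C"
  shows category_Dom: "f \<in> Mor C \<Longrightarrow> Dom C f \<in> Ob C"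
    and category_Cod: "f \<in> Mor C \<Longrightarrow> Cod C f \<in> Ob C"
    and category_Idn: "a \<in> Ob C \<Longrightarrow> Idn C a \<in> hom C a a"
    and category_Comp: "\<lbrakk>f \<in> hom C a b; g \<in> hom C b c\<rbrakk> \<Longrightarrow> Comp C g f \<in> hom C a c"
    and category_Comp_Idn: "f \<in> hom C a b \<Longrightarrow> Comp C f (Idn C a) = f"
    and category_Idn_Comp: "f \<in> hom C a b \<Longrightarrow> Comp C (Idn C b) f = f"
    and category_assoc: "\<lbrakk>f \<in> hom C a b; g \<in> hom C b c; h \<in> hom C c d\<rbrakk> \<Longrightarrow>
      Comp C h (Comp C g f) = Comp C (Comp C h g) f"
  using assms by (simp_all add: category_def)

text \<open>Eliminating \<open>hom\<close> leaves side conditions that simplification can decide;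
  rules about hom sets would leave the end objects to be guessed.\<close>

lemma
  assumes "small_categorder C"
  shows scat_Dom [simp]: "f \<in> Mor C \<Longrightarrow> Dom C f \<in> Ob C"
    and scat_Cod [simp]: "f \<in> Mor C \<Longrightarrow> Cod C f \<in> Ob C"
    and scat_Idn [simp]: "a \<in> Ob C \<Longrightarrow> Idn C a \<in> Mor C"
    and scat_Dom_Idn [simp]: "a \<in> Ob C \<Longrightarrow> Dom C (Idn C a) = a"
    and scat_Cod_Idn [simp]: "a \<in> Ob C \<Longrightarrow> Cod C (Idn C a) = a"
    and scat_Comp [simp]:
      "\<lbrakk>f \<in> Mor C; g \<in> Mor C; Cod C f = Dom C g\<rbrakk> \<Longrightarrow> Comp C g f \<in> Mor C"
    and scat_Dom_Comp [simp]:
      "\<lbrakk>f \<in> Mor C; g \<in> Mor C; Cod C f = Dom C g\<rbrakk> \<Longrightarrow> Dom C (Comp C g f) = Dom C f"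
    and scat_Cod_Comp [simp]:
      "\<lbrakk>f \<in> Mor C; g \<in> Mor C; Cod C f = Dom C g\<rbrakk> \<Longrightarrow> Cod C (Comp C g f) = Cod C g"
    and scat_Comp_Idn [simp]: "f \<in> Mor C \<Longrightarrow> Comp C f (Idn C (Dom C f)) = f"
    and scat_Idn_Comp [simp]: "f \<in> Mor C \<Longrightarrow> Comp C (Idn C (Cod C f)) f = f"
    and scat_assoc:
      "\<lbrakk>f \<in> Mor C; g \<in> Mor C; h \<in> Mor C; Cod C f = Dom C g; Cod C g = Dom C h\<rbrakk> \<Longrightarrow>
        Comp C h (Comp C g f) = Comp C (Comp C h g) f"
proof -
  have C: "category C"
    using assms by (simp add: small_categorder_def is_categorder_def)
  note facts = category_Idn[OF C] category_Comp[OF C] category_Comp_Idn[OF C]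
    category_Idn_Comp[OF C] category_assoc[OF C]
  show "f \<in> Mor C \<Longrightarrow> Dom C f \<in> Ob C" "f \<in> Mor C \<Longrightarrow> Cod C f \<in> Ob C"
    by (rule category_Dom[OF C] category_Cod[OF C], assumption)+
  show "a \<in> Ob C \<Longrightarrow> Idn C a \<in> Mor C" "a \<in> Ob C \<Longrightarrow> Dom C (Idn C a) = a"
    "a \<in> Ob C \<Longrightarrow> Cod C (Idn C a) = a"
    "f \<in> Mor C \<Longrightarrow> Comp C f (Idn C (Dom C f)) = f"
    "f \<in> Mor C \<Longrightarrow> Comp C (Idn C (Cod C f)) f = f"
    using facts by (simp_all add: hom_def)
  show "\<lbrakk>f \<in> Mor C; g \<in> Mor C; Cod C f = Dom C g\<rbrakk> \<Longrightarrow> Comp C g f \<in> Mor C"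
    "\<lbrakk>f \<in> Mor C; g \<in> Mor C; Cod C f = Dom C g\<rbrakk> \<Longrightarrow> Dom C (Comp C g f) = Dom C f"
    "\<lbrakk>f \<in> Mor C; g \<in> Mor C; Cod C f = Dom C g\<rbrakk> \<Longrightarrow> Cod C (Comp C g f) = Cod C g"
    using facts(2)[of f "Dom C f" "Dom C g" g "Cod C g"] by (simp_all add: hom_def)
  show "\<lbrakk>f \<in> Mor C; g \<in> Mor C; h \<in> Mor C; Cod C f = Dom C g; Cod C g = Dom C h\<rbrakk> \<Longrightarrow>
      Comp C h (Comp C g f) = Comp C (Comp C h g) f"
    using facts(5)[of f "Dom C f" "Dom C g" g "Dom C h" h "Cod C h"] by (simp add: hom_def)
qed

lemma
  assumes "small_categorder C"
  shows scat_leD: "le C f g \<Longrightarrow> f \<in> Mor C \<and> g \<in> Mor C \<and> Dom C f = Dom C g \<and> Cod C f = Cod C g"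
    and scat_refl [simp]: "f \<in> Mor C \<Longrightarrow> le C f f"
proof -
  have C: "is_categorder C"
    using assms by (simp add: small_categorder_def)
  show "le C f g \<Longrightarrow> f \<in> Mor C \<and> g \<in> Mor C \<and> Dom C f = Dom C g \<and> Cod C f = Cod C g"
    "f \<in> Mor C \<Longrightarrow> le C f f"
    using C by (simp_all add: is_categorder_def)
qed

lemma scat_trans: "\<lbrakk>small_categorder C; le C f g; le C g h\<rbrakk> \<Longrightarrow> le C f h"
  unfolding small_categorder_def is_categorder_def by (elim conjE) metis

text \<open>Composability is assumed for the lower pair only: comparable morphisms share domain and
  codomain, so the upper pair is composable as well.\<close>

lemma scat_Comp_mono:
  assumes "small_categorder C" "le C f f'" "le C g g'" "Cod C f = Dom C g"
  shows "le C (Comp C g f) (Comp C g' f')"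
proof -
  have mono: "\<forall>a b c. \<forall>f1\<in>hom C a b. \<forall>f2\<in>hom C a b. \<forall>g1\<in>hom C b c. \<forall>g2\<in>hom C b c.
       le C f1 f2 \<longrightarrow> le C g1 g2 \<longrightarrow> le C (Comp C g1 f1) (Comp C g2 f2)"
    using assms(1) unfolding small_categorder_def is_categorder_def by (elim conjE)
  have "f \<in> hom C (Dom C f) (Cod C f)" "f' \<in> hom C (Dom C f) (Cod C f)"
    "g \<in> hom C (Cod C f) (Cod C g)" "g' \<in> hom C (Cod C f) (Cod C g)"
    using assms scat_leD[OF assms(1)] by (auto simp: hom_def)
  then show ?thesis
    using mono assms(2,3) by blast
qed

lemma small_categorderI:
  assumes "category C"
    and "\<And>f g. le C f g \<Longrightarrow> f \<in> Mor C \<and> g \<in> Mor C \<and> Dom C f = Dom C g \<and> Cod C f = Cod C g"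
    and "\<And>f. f \<in> Mor C \<Longrightarrow> le C f f"
    and "\<And>f g. le C f g \<Longrightarrow> le C g f \<Longrightarrow> f = g"
    and "\<And>f g h. le C f g \<Longrightarrow> le C g h \<Longrightarrow> le C f h"
    and "\<And>f f' g g'. le C f f' \<Longrightarrow> le C g g' \<Longrightarrow> Cod C f = Dom C g \<Longrightarrow>
      le C (Comp C g f) (Comp C g' f')"
    and "small (Ob C)" "small (Mor C)"
    and "Dom C \<in> extensional (Mor C)" "Cod C \<in> extensional (Mor C)" "Idn C \<in> extensional (Ob C)"
    and "\<And>f g. \<not> (f \<in> Mor C \<and> g \<in> Mor C \<and> Cod C f = Dom C g) \<Longrightarrow> Comp C g f = undefined"
  shows "small_categorder C"
proof -
  have "is_categorder C"
    unfolding is_categorder_def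
  proof (intro conjI allI ballI impI)
    fix a b c f1 f2 g1 g2
    assume "f1 \<in> hom C a b" "g1 \<in> hom C b c" "le C f1 f2" "le C g1 g2"
    then show "le C (Comp C g1 f1) (Comp C g2 f2)"
      using assms(6) by (simp add: hom_def)
  qed (fact assms(1) | drule assms(2), simp | erule assms(3) | erule (1) assms(4)
    | erule (1) assms(5))+
  then show ?thesis
    using assms(7-) by (simp add: small_categorder_def)
qed

lemma
  assumes "is_functorder C D F"
  shows functorder_Ob: "a \<in> Ob C \<Longrightarrow> onOb F a \<in> Ob D"
    and functorder_Mor: "f \<in> Mor C \<Longrightarrow> onMor F f \<in> Mor D"
    and functorder_Dom: "f \<in> Mor C \<Longrightarrow> Dom D (onMor F f) = onOb F (Dom C f)"
    and functorder_Cod: "f \<in> Mor C \<Longrightarrow> Cod D (onMor F f) = onOb F (Cod C f)"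
    and functorder_mono: "le C f g \<Longrightarrow> le D (onMor F f) (onMor F g)"
    and functorder_Idn: "a \<in> Ob C \<Longrightarrow> le D (onMor F (Idn C a)) (Idn D (onOb F a))"
    and functorder_Comp: "\<lbrakk>f \<in> Mor C; g \<in> Mor C; Cod C f = Dom C g\<rbrakk> \<Longrightarrow>
      le D (onMor F (Comp C g f)) (Comp D (onMor F g) (onMor F f))"
proof -
  note F = assms[unfolded is_functorder_def]
  show "a \<in> Ob C \<Longrightarrow> onOb F a \<in> Ob D" "le C f g \<Longrightarrow> le D (onMor F f) (onMor F g)"
    "a \<in> Ob C \<Longrightarrow> le D (onMor F (Idn C a)) (Idn D (onOb F a))"
    using F by simp_all
  have hom: "f \<in> Mor C \<Longrightarrow> f \<in> hom C (Dom C f) (Cod C f)" for f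
    by (simp add: hom_def)
  have "onMor F f \<in> hom D (onOb F (Dom C f)) (onOb F (Cod C f))" if "f \<in> Mor C"
    using F hom[OF that] by blast
  then show "f \<in> Mor C \<Longrightarrow> onMor F f \<in> Mor D"
    "f \<in> Mor C \<Longrightarrow> Dom D (onMor F f) = onOb F (Dom C f)"
    "f \<in> Mor C \<Longrightarrow> Cod D (onMor F f) = onOb F (Cod C f)"
    by (simp_all add: hom_def)
  show "\<lbrakk>f \<in> Mor C; g \<in> Mor C; Cod C f = Dom C g\<rbrakk> \<Longrightarrow>
      le D (onMor F (Comp C g f)) (Comp D (onMor F g) (onMor F f))"
    using F hom[of f] hom[of g] by metis
qed

lemma functorderI:
  assumes "\<And>a. a \<in> Ob C \<Longrightarrow> onOb F a \<in> Ob D"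
    and "\<And>f. f \<in> Mor C \<Longrightarrow> onMor F f \<in> Mor D \<and>
      Dom D (onMor F f) = onOb F (Dom C f) \<and> Cod D (onMor F f) = onOb F (Cod C f)"
    and "\<And>f g. le C f g \<Longrightarrow> le D (onMor F f) (onMor F g)"
    and "\<And>a. a \<in> Ob C \<Longrightarrow> le D (onMor F (Idn C a)) (Idn D (onOb F a))"
    and "\<And>f g. f \<in> Mor C \<Longrightarrow> g \<in> Mor C \<Longrightarrow> Cod C f = Dom C g \<Longrightarrow>
      le D (onMor F (Comp C g f)) (Comp D (onMor F g) (onMor F f))"
  shows "is_functorder C D F"
  using assms unfolding is_functorder_def hom_def by auto

section \<open>The category of small categorders\<close>

lemma Cat1_simps [simp]:
  "Ob Cat1 = {C. small_categorder C}"
  "(C, F, D) \<in> Mor Cat1 \<longleftrightarrow> small_categorder C \<and> small_categorder D \<and> is_functorder C D F \<and>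
    onOb F \<in> extensional (Ob C) \<and> onMor F \<in> extensional (Mor C)"
  "Dom Cat1 (C, F, D) = C"
  "Cod Cat1 (C, F, D) = D"
  "Idn Cat1 C = (C, \<lparr>onOb = \<lambda>a\<in>Ob C. a, onMor = \<lambda>f\<in>Mor C. f\<rparr>, C)"
  "Comp Cat1 (D', G, E) (C, F, D) = (C, \<lparr>onOb = compose (Ob C) (onOb G) (onOb F),
    onMor = compose (Mor C) (onMor G) (onMor F)\<rparr>, E)"
  by (simp_all add: Cat1_def)

lemma hom_Cat1:
  "m \<in> hom Cat1 C D \<longleftrightarrow> (\<exists>F. m = (C, F, D) \<and> (C, F, D) \<in> Mor Cat1)"
  by (cases m) (auto simp: hom_def)

text \<open>Membership in \<open>Mor Cat1\<close> makes both components extensional, so agreement on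
  the carriers of \<open>C\<close> already determines the records.\<close>

lemma Cat1_mor_eqI:
  assumes "(C, F, D) \<in> Mor Cat1" "(C, G, D) \<in> Mor Cat1"
    and "\<And>a. a \<in> Ob C \<Longrightarrow> onOb F a = onOb G a"
    and "\<And>f. f \<in> Mor C \<Longrightarrow> onMor F f = onMor G f"
  shows "(C, F, D) = (C, G, D)"
  using assms by (auto intro!: fmap.equality intro: extensionalityI)

lemma functorder_id:
  "small_categorder C \<Longrightarrow> is_functorder C C \<lparr>onOb = \<lambda>a\<in>Ob C. a, onMor = \<lambda>f\<in>Mor C. f\<rparr>"
  by (rule functorderI) (auto dest: scat_leD)

text \<open>The lax inequalities chain: monotonicity of \<open>G\<close> carries the one for
  \<open>F\<close> into \<open>E\<close>, and the one for \<open>G\<close> follows by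
  transitivity.\<close>

lemma functorder_compose:
  assumes C: "small_categorder C" and D: "small_categorder D" and E: "small_categorder E"
    and F: "is_functorder C D F" and G: "is_functorder D E G"
  shows "is_functorder C E \<lparr>onOb = compose (Ob C) (onOb G) (onOb F),
    onMor = compose (Mor C) (onMor G) (onMor F)\<rparr>" (is "is_functorder C E ?H")
proof -
  have Ob: "onOb ?H a = onOb G (onOb F a)" if "a \<in> Ob C" for a
    using that by (simp add: compose_def)
  have Mor: "onMor ?H f = onMor G (onMor F f)" if "f \<in> Mor C" for f
    using that by (simp add: compose_def)
  show ?thesis
  proof (rule functorderI)
    fix f assume "f \<in> Mor C"
    then show "onMor ?H f \<in> Mor E \<and> Dom E (onMor ?H f) = onOb ?H (Dom C f) \<and>
        Cod E (onMor ?H f) = onOb ?H (Cod C f)"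
      by (simp only: Mor Ob scat_Dom[OF C] scat_Cod[OF C] functorder_Mor[OF F] functorder_Mor[OF G]
          functorder_Dom[OF F] functorder_Dom[OF G] functorder_Cod[OF F] functorder_Cod[OF G])
  next
    fix f g assume "le C f g"
    then show "le E (onMor ?H f) (onMor ?H g)"
      using scat_leD[OF C] by (simp only: Mor functorder_mono[OF F] functorder_mono[OF G])
  next
    fix a assume "a \<in> Ob C"
    then show "le E (onMor ?H (Idn C a)) (Idn E (onOb ?H a))"
      using scat_trans[OF E functorder_mono[OF G functorder_Idn[OF F]] functorder_Idn[OF G]]
      by (simp only: Mor Ob scat_Idn[OF C] functorder_Ob[OF F])
  next
    fix f g assume "f \<in> Mor C" "g \<in> Mor C" "Cod C f = Dom C g"
    then show "le E (onMor ?H (Comp C g f)) (Comp E (onMor ?H g) (onMor ?H f))"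
      using scat_trans[OF E functorder_mono[OF G functorder_Comp[OF F]] functorder_Comp[OF G]]
      by (simp only: Mor scat_Comp[OF C] functorder_Mor[OF F] functorder_Dom[OF F]
          functorder_Cod[OF F])
  qed (simp only: Ob functorder_Ob[OF F] functorder_Ob[OF G])
qed

lemma Mor_Cat1E:
  assumes "m \<in> Mor Cat1"
  obtains C F D where "m = (C, F, D)" "(C, F, D) \<in> Mor Cat1"
  using assms by (cases m) auto

lemma category_Cat1: "category (Cat1 :: ('v::universe scat, 'v fo) cat)"
proof (rule categoryI)
  fix m n k :: "'v fo"
  assume m: "m \<in> Mor Cat1" and n: "n \<in> Mor Cat1"
  obtain C F D where "m = (C, F, D)" "(C, F, D) \<in> Mor Cat1"
    using m by (rule Mor_Cat1E)
  moreover obtain D' G E where "n = (D', G, E)" "(D', G, E) \<in> Mor Cat1"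
    using n by (rule Mor_Cat1E)
  ultimately have mn: "m = (C, F, D)" "n = (D', G, E)" "(C, F, D) \<in> Mor Cat1"
    "(D', G, E) \<in> Mor Cat1"
    by simp_all
  assume "Cod Cat1 m = Dom Cat1 n"
  with mn have D': "D' = D"
    by simp
  show "Comp Cat1 n m \<in> Mor Cat1 \<and> Dom Cat1 (Comp Cat1 n m) = Dom Cat1 m \<and>
      Cod Cat1 (Comp Cat1 n m) = Cod Cat1 n"
    using mn by (simp add: D' functorder_compose[of C D E F G])
  assume "k \<in> Mor Cat1" "Cod Cat1 n = Dom Cat1 k"
  then obtain H K where k: "k = (E, H, K)"
    using mn by (cases k) simp
  have F: "is_functorder C D F"
    using mn by simp
  show "Comp Cat1 k (Comp Cat1 n m) = Comp Cat1 (Comp Cat1 k n) m"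
    by (simp add: mn k D' compose_def restrict_def fun_eq_iff functorder_Ob[OF F] functorder_Mor[OF F])
next
  fix m :: "'v fo"
  assume "m \<in> Mor Cat1"
  then obtain C F D where m: "m = (C, F, D)" "(C, F, D) \<in> Mor Cat1"
    by (rule Mor_Cat1E)
  then have "onOb F ` Ob C \<subseteq> Ob D" "onMor F ` Mor C \<subseteq> Mor D"
    by (auto simp: functorder_Ob functorder_Mor)
  with m show "Comp Cat1 m (Idn Cat1 (Dom Cat1 m)) = m \<and>
      Comp Cat1 (Idn Cat1 (Cod Cat1 m)) m = m" "Dom Cat1 m \<in> Ob Cat1 \<and> Cod Cat1 m \<in> Ob Cat1"
    by (simp_all add: compose_restrict_id_right compose_restrict_id_left)
qed (simp_all add: functorder_id)


section \<open>The power categorder\<close>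

lemma mem_down [simp]: "f \<in> down C A \<longleftrightarrow> (\<exists>g\<in>A. le C f g)"
  by (simp add: down_def)

text \<open>The underlying set of a composite in \<open>P1_cat C\<close>, detached from the triples,
  so that the category laws become statements about sets of morphisms of \<open>C\<close>. The
  argument order is that of \<open>Comp\<close>.\<close>

definition comps :: "('o, 'm) categorder \<Rightarrow> 'm set \<Rightarrow> 'm set \<Rightarrow> 'm set"
  where "comps C B A = down C {Comp C g f | f g. f \<in> A \<and> g \<in> B \<and> Cod C f = Dom C g}"

lemma mem_comps [simp]:
  "h \<in> comps C B A \<longleftrightarrow> (\<exists>f\<in>A. \<exists>g\<in>B. Cod C f = Dom C g \<and> le C h (Comp C g f))"
  by (auto simp: comps_def)

lemma downI: "g \<in> A \<Longrightarrow> le C f g \<Longrightarrow> f \<in> down C A"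
  by auto

lemma down_closed: "small_categorder C \<Longrightarrow> g \<in> down C A \<Longrightarrow> le C f g \<Longrightarrow> f \<in> down C A"
  unfolding mem_down by (blast intro: scat_trans)

lemma compsI: "\<lbrakk>f \<in> A; g \<in> B; Cod C f = Dom C g; le C h (Comp C g f)\<rbrakk> \<Longrightarrow> h \<in> comps C B A"
  by auto

lemma comps_closed:
  "small_categorder C \<Longrightarrow> g \<in> comps C B A \<Longrightarrow> le C f g \<Longrightarrow> f \<in> comps C B A"
  unfolding comps_def by (rule down_closed)

lemma elts_vset_Mor:
  assumes "small_categorder C" "A \<subseteq> Mor C"
  shows "elts (vset A) = A"
proof -
  have "small (Mor C)"
    using assms(1) by (simp add: small_categorder_def)
  then show ?thesis
    by (meson assms(2) small_subset elts_vset)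
qed

text \<open>Unconditional in \<open>A\<close>, because \<open>le\<close> relates only morphisms and
  a down closure therefore always lies in the small set \<open>Mor C\<close>.\<close>

lemma elts_vset_down [simp]: "small_categorder C \<Longrightarrow> elts (vset (down C A)) = down C A"
  by (rule elts_vset_Mor) (auto dest: scat_leD)

lemma elts_vset_comps [simp]: "small_categorder C \<Longrightarrow> elts (vset (comps C B A)) = comps C B A"
  by (simp add: comps_def)

section \<open>Morphisms, identities and composition of the power categorder\<close>

lemma triple_inject [simp]: "triple X Y a = triple X' Y' a' \<longleftrightarrow> X = X' \<and> Y = Y' \<and> a = a'"
  by (simp add: triple_def)

lemma P1_MorI:
  assumes "elts X \<subseteq> Ob C" "elts Y \<subseteq> Ob C"
    and "\<And>f. f \<in> elts a \<Longrightarrow> f \<in> Mor C \<and> Dom C f \<in> elts X \<and> Cod C f \<in> elts Y"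
    and "\<And>f g. g \<in> elts a \<Longrightarrow> le C f g \<Longrightarrow> f \<in> elts a"
  shows "triple X Y a \<in> P1_Mor C"
proof -
  have "elts a \<subseteq> (\<Union>c\<in>elts X. \<Union>c'\<in>elts Y. hom C c c')"
    using assms(3) by (auto simp: hom_def)
  moreover have "down C (elts a) \<subseteq> elts a"
    using assms(4) by auto
  ultimately show ?thesis
    unfolding P1_Mor_def using assms(1,2) by auto
qed

lemma P1_MorE:
  assumes "m \<in> P1_Mor C"
  obtains X Y a where "m = triple X Y a" "elts X \<subseteq> Ob C" "elts Y \<subseteq> Ob C"
    "elts a \<subseteq> (\<Union>c\<in>elts X. \<Union>c'\<in>elts Y. hom C c c')" "down C (elts a) \<subseteq> elts a"
  using assms unfolding P1_Mor_def mem_Collect_eq mem_vPow by blast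

lemma P1_Mor_triple: "m \<in> P1_Mor C \<Longrightarrow> triple (tdom m) (tcod m) (tset m) = m"
  by (elim P1_MorE) simp

lemma P1_Mor_tdom: "m \<in> P1_Mor C \<Longrightarrow> elts (tdom m) \<subseteq> Ob C"
  by (elim P1_MorE) simp

lemma P1_Mor_tcod: "m \<in> P1_Mor C \<Longrightarrow> elts (tcod m) \<subseteq> Ob C"
  by (elim P1_MorE) simp

lemma P1_Mor_tset:
  assumes "m \<in> P1_Mor C" "f \<in> elts (tset m)"
  shows "f \<in> Mor C \<and> Dom C f \<in> elts (tdom m) \<and> Cod C f \<in> elts (tcod m)"
  using assms by (elim P1_MorE) (auto simp: hom_def)

lemma P1_Mor_down:
  assumes "m \<in> P1_Mor C" "g \<in> elts (tset m)" "le C f g"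
  shows "f \<in> elts (tset m)"
  using assms by (elim P1_MorE) (auto simp: subset_iff)

lemma P1_Mor_eqI:
  assumes "m \<in> P1_Mor C" "n \<in> P1_Mor C" "tdom m = tdom n" "tcod m = tcod n"
    and "elts (tset m) = elts (tset n)"
  shows "m = n"
  using assms by (metis P1_Mor_triple elts_inject)

text \<open>A morphism is coded by two subsets of \<open>Ob C\<close> and one of
  \<open>Mor C\<close>, so power sets, images and unions of small sets bound the collection of all
  of them.\<close>

lemma small_P1_Mor:
  assumes "small_categorder C"
  shows "small (P1_Mor C)"
proof (rule small_subset)
  have "small (Ob C)" "small (Mor C)"
    using assms by (simp_all add: small_categorder_def)
  then show "small (\<Union>X\<in>vPow (Ob C). \<Union>Y\<in>vPow (Ob C). triple X Y ` vPow (Mor C))"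
    by simp
  show "P1_Mor C \<subseteq> (\<Union>X\<in>vPow (Ob C). \<Union>Y\<in>vPow (Ob C). triple X Y ` vPow (Mor C))"
  proof
    fix m assume m: "m \<in> P1_Mor C"
    then have "m = triple (tdom m) (tcod m) (tset m)" "elts (tset m) \<subseteq> Mor C"
      by (simp_all add: P1_Mor_triple P1_Mor_tset subset_iff)
    moreover have "tdom m \<in> vPow (Ob C)" "tcod m \<in> vPow (Ob C)"
      using P1_Mor_tdom[OF m] P1_Mor_tcod[OF m] by simp_all
    ultimately show "m \<in> (\<Union>X\<in>vPow (Ob C). \<Union>Y\<in>vPow (Ob C). triple X Y ` vPow (Mor C))"
      by (metis (no_types, lifting) UN_I imageI mem_vPow)
  qed
qed

lemma P1_cat_simps [simp]:
  "Ob (P1_cat C) = vPow (Ob C)"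
  "Mor (P1_cat C) = P1_Mor C"
  "m \<in> P1_Mor C \<Longrightarrow> Dom (P1_cat C) m = tdom m"
  "m \<in> P1_Mor C \<Longrightarrow> Cod (P1_cat C) m = tcod m"
  "elts X \<subseteq> Ob C \<Longrightarrow> Idn (P1_cat C) X = triple X X (vset (down C (Idn C ` elts X)))"
  "\<lbrakk>m \<in> P1_Mor C; n \<in> P1_Mor C; tcod m = tdom n\<rbrakk> \<Longrightarrow> Comp (P1_cat C) n m =
    triple (tdom m) (tcod n) (vset (comps C (elts (tset n)) (elts (tset m))))"
  "le (P1_cat C) m n \<longleftrightarrow> m \<in> P1_Mor C \<and> n \<in> P1_Mor C \<and> tdom m = tdom n \<and> tcod m = tcod n \<and>
    elts (tset m) \<subseteq> elts (tset n)"
  by (simp_all add: P1_cat_def comps_def)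

text \<open>Stated for the explicit triple because \<open>P1_cat_simps\<close> rewrites
  \<open>Idn (P1_cat C) X\<close> to it before its membership is asked for.\<close>

lemma P1_Idn_in_P1_Mor:
  assumes C: "small_categorder C" and X: "elts X \<subseteq> Ob C"
  shows "triple X X (vset (down C (Idn C ` elts X))) \<in> P1_Mor C"
proof (rule P1_MorI)
  fix f assume "f \<in> elts (vset (down C (Idn C ` elts X)))"
  then obtain c where "c \<in> elts X" "le C f (Idn C c)"
    using C by auto
  then show "f \<in> Mor C \<and> Dom C f \<in> elts X \<and> Cod C f \<in> elts X"
    using X scat_leD[OF C, of f "Idn C c"] C by (simp add: subset_iff)
next
  fix f g assume "g \<in> elts (vset (down C (Idn C ` elts X)))" "le C f g"
  then show "f \<in> elts (vset (down C (Idn C ` elts X)))"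
    using C by (simp add: down_closed del: mem_down)
qed (use X in auto)

text \<open>The ends \<open>X\<close> and \<open>Z\<close> are tied to \<open>m\<close> and
  \<open>n\<close> by equations, so that the rule still applies after a composability hypothesis has
  rewritten \<open>tcod n\<close> to the domain of the next morphism.\<close>

lemma P1_Comp_in_P1_Mor:
  assumes C: "small_categorder C" and m: "m \<in> P1_Mor C" "tdom m = X"
    and n: "n \<in> P1_Mor C" "tcod n = Z"
  shows "triple X Z (vset (comps C (elts (tset n)) (elts (tset m)))) \<in> P1_Mor C"
proof (rule P1_MorI)
  fix h assume "h \<in> elts (vset (comps C (elts (tset n)) (elts (tset m))))"
  then obtain f g where "f \<in> elts (tset m)" "g \<in> elts (tset n)" "Cod C f = Dom C g"
    "le C h (Comp C g f)"
    using C by auto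
  then show "h \<in> Mor C \<and> Dom C h \<in> elts X \<and> Cod C h \<in> elts Z"
    using P1_Mor_tset[OF m(1)] P1_Mor_tset[OF n(1)] scat_leD[OF C, of h "Comp C g f"] C m(2) n(2)
    by simp
next
  fix f g assume "g \<in> elts (vset (comps C (elts (tset n)) (elts (tset m))))" "le C f g"
  then show "f \<in> elts (vset (comps C (elts (tset n)) (elts (tset m))))"
    using C by (simp add: comps_closed del: mem_comps)
qed (use P1_Mor_tdom[OF m(1)] P1_Mor_tcod[OF n(1)] m(2) n(2) in auto)

lemma P1_Comp_closed:
  assumes "small_categorder C" "m \<in> P1_Mor C" "n \<in> P1_Mor C" "tcod m = tdom n"
  shows "Comp (P1_cat C) n m \<in> P1_Mor C"
  using assms by (simp add: P1_Comp_in_P1_Mor)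

text \<open>A morphism \<open>f\<close> below an identity can only decrease what it is composed
  with: \<open>Comp C g f\<close> lies below \<open>g\<close> by monotonicity, hence in the down
  closed set of \<open>m\<close>. Conversely each element is its own composite with an
  identity.\<close>

lemma comps_Idn_right:
  assumes C: "small_categorder C" and m: "m \<in> P1_Mor C"
  shows "comps C (elts (tset m)) (down C (Idn C ` elts (tdom m))) = elts (tset m)"
proof (intro equalityI subsetI)
  fix h assume "h \<in> comps C (elts (tset m)) (down C (Idn C ` elts (tdom m)))"
  then obtain c f g where *: "c \<in> elts (tdom m)" "le C f (Idn C c)" "g \<in> elts (tset m)"
    "Cod C f = Dom C g" "le C h (Comp C g f)"
    by auto
  have c: "c \<in> Ob C"
    using *(1) P1_Mor_tdom[OF m] by auto
  have g: "g \<in> Mor C"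
    using P1_Mor_tset[OF m *(3)] by simp
  have "Dom C g = c"
    using scat_leD[OF C *(2)] *(4) c C by simp
  then have "Comp C g (Idn C c) = g"
    using scat_Comp_Idn[OF C g] by simp
  then have "le C (Comp C g f) g"
    using scat_Comp_mono[OF C *(2) scat_refl[OF C g] *(4)] by simp
  then show "h \<in> elts (tset m)"
    using P1_Mor_down[OF m *(3)] scat_trans[OF C *(5)] by blast
next
  fix h assume h: "h \<in> elts (tset m)"
  then have h': "h \<in> Mor C" "Dom C h \<in> elts (tdom m)"
    using P1_Mor_tset[OF m] by auto
  have "le C (Idn C (Dom C h)) (Idn C (Dom C h))" "Cod C (Idn C (Dom C h)) = Dom C h"
    "le C h (Comp C h (Idn C (Dom C h)))"
    using h' C by simp_all
  then show "h \<in> comps C (elts (tset m)) (down C (Idn C ` elts (tdom m)))"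
    using h h'(2) by (blast intro: compsI downI)
qed

lemma comps_Idn_left:
  assumes C: "small_categorder C" and m: "m \<in> P1_Mor C"
  shows "comps C (down C (Idn C ` elts (tcod m))) (elts (tset m)) = elts (tset m)"
proof (intro equalityI subsetI)
  fix h assume "h \<in> comps C (down C (Idn C ` elts (tcod m))) (elts (tset m))"
  then obtain c f g where *: "c \<in> elts (tcod m)" "le C f (Idn C c)" "g \<in> elts (tset m)"
    "Cod C g = Dom C f" "le C h (Comp C f g)"
    by auto
  have c: "c \<in> Ob C"
    using *(1) P1_Mor_tcod[OF m] by auto
  have g: "g \<in> Mor C"
    using P1_Mor_tset[OF m *(3)] by simp
  have "Cod C g = c"
    using scat_leD[OF C *(2)] *(4) c C by simp
  then have "Comp C (Idn C c) g = g"
    using scat_Idn_Comp[OF C g] by simp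
  then have "le C (Comp C f g) g"
    using scat_Comp_mono[OF C scat_refl[OF C g] *(2,4)] by simp
  then show "h \<in> elts (tset m)"
    using P1_Mor_down[OF m *(3)] scat_trans[OF C *(5)] by blast
next
  fix h assume h: "h \<in> elts (tset m)"
  then have h': "h \<in> Mor C" "Cod C h \<in> elts (tcod m)"
    using P1_Mor_tset[OF m] by auto
  have "le C (Idn C (Cod C h)) (Idn C (Cod C h))" "Cod C h = Dom C (Idn C (Cod C h))"
    "le C h (Comp C (Idn C (Cod C h)) h)"
    using h' C by simp_all
  then show "h \<in> comps C (down C (Idn C ` elts (tcod m))) (elts (tset m))"
    using h h'(2) by (blast intro: compsI downI)
qed

text \<open>Both sides are the down closure of the threefold composites. An inner \<open>x\<close>
  below a composite has the same ends as that composite, so the composite can replace it without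
  losing composability, and monotonicity keeps the bound.\<close>

lemma comps_assoc:
  assumes C: "small_categorder C" and sub: "A \<subseteq> Mor C" "B \<subseteq> Mor C" "D \<subseteq> Mor C"
  shows "comps C D (comps C B A) = comps C (comps C D B) A"
proof (intro equalityI subsetI)
  fix k assume "k \<in> comps C D (comps C B A)"
  then obtain f g h x where *: "f \<in> A" "g \<in> B" "Cod C f = Dom C g" "le C x (Comp C g f)"
    "h \<in> D" "Cod C x = Dom C h" "le C k (Comp C h x)"
    by auto
  have M: "f \<in> Mor C" "g \<in> Mor C" "h \<in> Mor C"
    using * sub by auto
  have gh: "Cod C g = Dom C h"
    using scat_leD[OF C *(4)] *(3,6) M C by simp
  have "le C k (Comp C (Comp C h g) f)"
    using scat_trans[OF C *(7) scat_Comp_mono[OF C *(4) scat_refl[OF C M(3)] *(6)]]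
      scat_assoc[OF C M *(3) gh] by simp
  moreover have "le C (Comp C h g) (Comp C h g)" "Cod C f = Dom C (Comp C h g)"
    using C M gh *(3) by simp_all
  ultimately show "k \<in> comps C (comps C D B) A"
    using compsI[OF *(2,5) gh] *(1) by (blast intro: compsI)
next
  fix k assume "k \<in> comps C (comps C D B) A"
  then obtain f g h x where *: "g \<in> B" "h \<in> D" "Cod C g = Dom C h" "le C x (Comp C h g)"
    "f \<in> A" "Cod C f = Dom C x" "le C k (Comp C x f)"
    by auto
  have M: "f \<in> Mor C" "g \<in> Mor C" "h \<in> Mor C"
    using * sub by auto
  have fg: "Cod C f = Dom C g"
    using scat_leD[OF C *(4)] *(3,6) M C by simp
  have "le C k (Comp C h (Comp C g f))"
    using scat_trans[OF C *(7) scat_Comp_mono[OF C scat_refl[OF C M(1)] *(4,6)]]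
      scat_assoc[OF C M fg *(3)] by simp
  moreover have "le C (Comp C g f) (Comp C g f)" "Cod C (Comp C g f) = Dom C h"
    using C M fg *(3) by simp_all
  ultimately show "k \<in> comps C D (comps C B A)"
    using compsI[OF *(5,1) fg] *(2) by (blast intro: compsI)
qed

lemma comps_mono:
  assumes "A \<subseteq> A'" "B \<subseteq> B'"
  shows "comps C B A \<subseteq> comps C B' A'"
  using assms by (auto simp: subset_iff)

lemma category_P1_cat:
  assumes C: "small_categorder C"
  shows "category (P1_cat C)"
proof (rule categoryI)
  fix m n k
  assume "m \<in> Mor (P1_cat C)" "n \<in> Mor (P1_cat C)" "k \<in> Mor (P1_cat C)"
    and "Cod (P1_cat C) m = Dom (P1_cat C) n" "Cod (P1_cat C) n = Dom (P1_cat C) k"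
  then have M: "m \<in> P1_Mor C" "n \<in> P1_Mor C" "k \<in> P1_Mor C"
    and eq: "tcod m = tdom n" "tcod n = tdom k"
    by simp_all
  have "elts (tset m) \<subseteq> Mor C" "elts (tset n) \<subseteq> Mor C" "elts (tset k) \<subseteq> Mor C"
    using M by (auto dest: P1_Mor_tset)
  then show "Comp (P1_cat C) k (Comp (P1_cat C) n m) = Comp (P1_cat C) (Comp (P1_cat C) k n) m"
    using M eq C by (simp add: P1_Comp_in_P1_Mor comps_assoc)
next
  fix m assume "m \<in> Mor (P1_cat C)"
  then have m: "m \<in> P1_Mor C"
    by simp
  then show "Comp (P1_cat C) m (Idn (P1_cat C) (Dom (P1_cat C) m)) = m \<and>
      Comp (P1_cat C) (Idn (P1_cat C) (Cod (P1_cat C) m)) m = m"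
    using C by (simp add: P1_Mor_tdom P1_Mor_tcod P1_Idn_in_P1_Mor comps_Idn_right comps_Idn_left
        P1_Mor_triple)
qed (simp_all add: C P1_Mor_tdom P1_Mor_tcod P1_Idn_in_P1_Mor P1_Comp_in_P1_Mor)

lemma small_categorder_P1_cat:
  assumes C: "small_categorder C"
  shows "small_categorder (P1_cat C)"
proof (rule small_categorderI)
  fix m n assume "le (P1_cat C) m n" "le (P1_cat C) n m"
  then show "m = n"
    by (auto intro: P1_Mor_eqI)
next
  fix m m' n n'
  assume "le (P1_cat C) m m'" "le (P1_cat C) n n'" "Cod (P1_cat C) m = Dom (P1_cat C) n"
  then show "le (P1_cat C) (Comp (P1_cat C) n m) (Comp (P1_cat C) n' m')"
    by (simp add: C P1_Comp_in_P1_Mor comps_mono del: mem_comps)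
next
  have "small (Ob C)"
    using C by (simp add: small_categorder_def)
  then show "small (Ob (P1_cat C))"
    by simp
\<comment> \<open>The extensionality clauses concern values outside the carriers, where
  \<open>P1_cat_simps\<close> says nothing; hence the unfolding of
  \<open>P1_cat_def\<close>.\<close>
qed (auto simp: C category_P1_cat small_P1_Mor, simp_all add: P1_cat_def)


section \<open>The power categorder monad\<close>

text \<open>The maps inside the arrows of \<open>P1\<close> get names of their own, so that
  simplification knows them only through their values on the carriers. Both categorders are
  arguments: \<open>C\<close> gives the carriers, and \<open>D\<close> is where the down closure is
  taken.\<close>

definition P1_map :: "'v::universe scat \<Rightarrow> ('v, 'v, 'v, 'v) fmap \<Rightarrow> 'v scat \<Rightarrow> ('v, 'v, 'v, 'v) fmap"
  where "P1_map C F D = fst (snd (onMor P1_fun (C, F, D)))"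

definition P1_unit :: "'v::universe scat \<Rightarrow> ('v, 'v, 'v, 'v) fmap"
  where "P1_unit C = fst (snd (unit P1 C))"

definition P1_mult :: "'v::universe scat \<Rightarrow> ('v, 'v, 'v, 'v) fmap"
  where "P1_mult C = fst (snd (mult P1 C))"

lemma P1_simps [simp]:
  "Fun P1 = P1_fun"
  "onOb P1_fun C = P1_cat C"
  "onMor P1_fun (C, F, D) = (P1_cat C, P1_map C F D, P1_cat D)"
  "unit P1 C = (C, P1_unit C, P1_cat C)"
  "mult P1 C = (P1_cat (P1_cat C), P1_mult C, P1_cat C)"
  by (simp_all add: P1_def P1_fun_def P1_map_def P1_unit_def P1_mult_def)

lemma P1_map_simps [simp]:
  "elts X \<subseteq> Ob C \<Longrightarrow> onOb (P1_map C F D) X = vset (onOb F ` elts X)"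
  "m \<in> P1_Mor C \<Longrightarrow> onMor (P1_map C F D) m =
    triple (vset (onOb F ` elts (tdom m))) (vset (onOb F ` elts (tcod m)))
      (vset (down D (onMor F ` elts (tset m))))"
  "onOb (P1_map C F D) \<in> extensional (vPow (Ob C))"
  "onMor (P1_map C F D) \<in> extensional (P1_Mor C)"
  by (simp_all add: P1_map_def P1_fun_def)

lemma P1_unit_simps [simp]:
  "c \<in> Ob C \<Longrightarrow> onOb (P1_unit C) c = vset {c}"
  "f \<in> Mor C \<Longrightarrow> onMor (P1_unit C) f =
    triple (vset {Dom C f}) (vset {Cod C f}) (vset (down C {f}))"
  "onOb (P1_unit C) \<in> extensional (Ob C)"
  "onMor (P1_unit C) \<in> extensional (Mor C)"
  by (simp_all add: P1_unit_def P1_def)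

lemma P1_mult_simps [simp]:
  "elts X \<subseteq> vPow (Ob C) \<Longrightarrow> onOb (P1_mult C) X = vset (\<Union>x\<in>elts X. elts x)"
  "m \<in> P1_Mor (P1_cat C) \<Longrightarrow> onMor (P1_mult C) m =
    triple (vset (\<Union>x\<in>elts (tdom m). elts x)) (vset (\<Union>y\<in>elts (tcod m). elts y))
      (vset (\<Union>n\<in>elts (tset m). elts (tset n)))"
  "onOb (P1_mult C) \<in> extensional (vPow (vPow (Ob C)))"
  "onMor (P1_mult C) \<in> extensional (P1_Mor (P1_cat C))"
  by (simp_all add: P1_mult_def P1_def)

text \<open>The order in the target is inclusion, so each law reduces to following one element: a
  bound in \<open>C\<close> is pushed through \<open>F\<close> by monotonicity and then continued by
  the lax law of \<open>F\<close>.\<close>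

lemma functorder_P1_map:
  assumes C: "small_categorder C" and D: "small_categorder D" and F: "is_functorder C D F"
  shows "is_functorder (P1_cat C) (P1_cat D) (P1_map C F D)"
proof -
  have ob: "onOb F ` elts X \<subseteq> Ob D" if "elts X \<subseteq> Ob C" for X
    using that functorder_Ob[OF F] by blast
  have mor: "onMor (P1_map C F D) m \<in> P1_Mor D" if m: "m \<in> P1_Mor C" for m
    unfolding P1_map_simps(2)[OF m]
  proof (rule P1_MorI)
    fix f assume "f \<in> elts (vset (down D (onMor F ` elts (tset m))))"
    then obtain g where g: "g \<in> elts (tset m)" and le: "le D f (onMor F g)"
      using D by auto
    note g' = P1_Mor_tset[OF m g]
    with scat_leD[OF D le] show "f \<in> Mor D \<and> Dom D f \<in> elts (vset (onOb F ` elts (tdom m))) \<and>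
        Cod D f \<in> elts (vset (onOb F ` elts (tcod m)))"
      by (simp add: functorder_Dom[OF F] functorder_Cod[OF F])
  next
    fix f g assume "g \<in> elts (vset (down D (onMor F ` elts (tset m))))" "le D f g"
    then show "f \<in> elts (vset (down D (onMor F ` elts (tset m))))"
      using D by (simp add: down_closed del: mem_down)
  qed (simp_all add: ob P1_Mor_tdom[OF m] P1_Mor_tcod[OF m])
  show ?thesis
  proof (rule functorderI)
    fix m assume "m \<in> Mor (P1_cat C)"
    then show "onMor (P1_map C F D) m \<in> Mor (P1_cat D) \<and>
      Dom (P1_cat D) (onMor (P1_map C F D) m) = onOb (P1_map C F D) (Dom (P1_cat C) m) \<and>
      Cod (P1_cat D) (onMor (P1_map C F D) m) = onOb (P1_map C F D) (Cod (P1_cat C) m)"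
      using mor[of m] by (simp add: P1_Mor_tdom P1_Mor_tcod)
  next
    fix m n assume "le (P1_cat C) m n"
    then have mn: "m \<in> P1_Mor C" "n \<in> P1_Mor C" "tdom m = tdom n" "tcod m = tcod n"
      "elts (tset m) \<subseteq> elts (tset n)"
      by simp_all
    have "down D (onMor F ` elts (tset m)) \<subseteq> down D (onMor F ` elts (tset n))"
      using mn(5) unfolding down_def by blast
    then show "le (P1_cat D) (onMor (P1_map C F D) m) (onMor (P1_map C F D) n)"
      using mor[OF mn(1)] mor[OF mn(2)] mn D by simp
  next
    fix X assume "X \<in> Ob (P1_cat C)"
    then have X: "elts X \<subseteq> Ob C"
      by simp
    have "down D (onMor F ` down C (Idn C ` elts X)) \<subseteq> down D (Idn D ` onOb F ` elts X)"
    proof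
      fix f assume "f \<in> down D (onMor F ` down C (Idn C ` elts X))"
      then obtain g c where "le D f (onMor F g)" "le C g (Idn C c)" "c \<in> elts X"
        by auto
      \<comment> \<open>The chain is \<open>f\<close> \<le> \<open>F g\<close> \<le>
        \<open>F (id c)\<close> \<le> \<open>id (F c)\<close>, the last step being the lax identity
        law.\<close>
      with X have "le D f (Idn D (onOb F c))"
        by (meson functorder_Idn[OF F] functorder_mono[OF F] scat_trans[OF D] subsetD)
      with \<open>c \<in> elts X\<close> show "f \<in> down D (Idn D ` onOb F ` elts X)"
        by (blast intro: downI)
    qed
    then show "le (P1_cat D) (onMor (P1_map C F D) (Idn (P1_cat C) X))
        (Idn (P1_cat D) (onOb (P1_map C F D) X))"
      using mor[OF P1_Idn_in_P1_Mor[OF C X]] P1_Idn_in_P1_Mor[OF C X] X C D ob[OF X]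
        P1_Idn_in_P1_Mor[OF D, of "vset (onOb F ` elts X)"]
      by simp
  next
    fix m n
    assume "m \<in> Mor (P1_cat C)" "n \<in> Mor (P1_cat C)" "Cod (P1_cat C) m = Dom (P1_cat C) n"
    then have m: "m \<in> P1_Mor C" and n: "n \<in> P1_Mor C" and eq: "tcod m = tdom n"
      by simp_all
    have "down D (onMor F ` comps C (elts (tset n)) (elts (tset m))) \<subseteq>
      comps D (down D (onMor F ` elts (tset n))) (down D (onMor F ` elts (tset m)))"
    proof
      fix h assume "h \<in> down D (onMor F ` comps C (elts (tset n)) (elts (tset m)))"
      then obtain k f g where *: "le D h (onMor F k)" "le C k (Comp C g f)" "Cod C f = Dom C g"
        and fg: "f \<in> elts (tset m)" "g \<in> elts (tset n)"
        by auto
      have M: "f \<in> Mor C" "g \<in> Mor C"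
        using P1_Mor_tset[OF m fg(1)] P1_Mor_tset[OF n fg(2)] by simp_all
      \<comment> \<open>Here the chain is \<open>h\<close> \<le> \<open>F k\<close> \<le>
        \<open>F (g f)\<close> \<le> \<open>F g\<close> composed with \<open>F f\<close>.\<close>
      have "le D h (Comp D (onMor F g) (onMor F f))"
        using scat_trans[OF D *(1)] scat_trans[OF D functorder_mono[OF F *(2)]]
          functorder_Comp[OF F M *(3)] by blast
      moreover have "onMor F f \<in> down D (onMor F ` elts (tset m))"
        "onMor F g \<in> down D (onMor F ` elts (tset n))"
        using fg M functorder_Mor[OF F] scat_refl[OF D] by (auto intro!: downI)
      moreover have "Cod D (onMor F f) = Dom D (onMor F g)"
        using M *(3) by (simp add: functorder_Dom[OF F] functorder_Cod[OF F])
      ultimately show "h \<in> comps D (down D (onMor F ` elts (tset n)))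
          (down D (onMor F ` elts (tset m)))"
        by (blast intro: compsI)
    qed
    moreover have "Comp (P1_cat C) n m \<in> P1_Mor C"
      by (rule P1_Comp_closed[OF C m n eq])
    moreover have "Comp (P1_cat D) (onMor (P1_map C F D) n) (onMor (P1_map C F D) m) \<in> P1_Mor D"
      by (rule P1_Comp_closed[OF D mor[OF m] mor[OF n]]) (simp add: m n eq)
    ultimately show "le (P1_cat D) (onMor (P1_map C F D) (Comp (P1_cat C) n m))
        (Comp (P1_cat D) (onMor (P1_map C F D) n) (onMor (P1_map C F D) m))"
      using mor[OF m] mor[OF n] mor[of "Comp (P1_cat C) n m"] m n eq C D
      by (simp del: mem_comps mem_down)
  qed (use ob in auto)
qed

section \<open>Strict functoriality of the power construction\<close>

lemma P1_map_Cat1: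
  "(C, F, D) \<in> Mor Cat1 \<Longrightarrow> (P1_cat C, P1_map C F D, P1_cat D) \<in> Mor Cat1"
  by (simp add: functorder_P1_map small_categorder_P1_cat)

lemma Cat1_Comp_Mor:
  assumes "(C, F, D) \<in> Mor Cat1" "(D, G, E) \<in> Mor Cat1"
  shows "Comp Cat1 (D, G, E) (C, F, D) \<in> Mor Cat1"
  using assms functorder_compose[of C D E F G] by simp

lemma P1_Mor_tset_subset: "m \<in> P1_Mor C \<Longrightarrow> elts (tset m) \<subseteq> Mor C"
  using P1_Mor_tset by blast

text \<open>This absorption makes \<open>P1_fun\<close> preserve composition on the nose, although
  functorders themselves are only lax. The inclusion of \<open>A\<close> in \<open>Mor D\<close>
  supplies reflexivity, so that \<open>A\<close> is contained in \<open>down D A\<close>.\<close>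

lemma down_image_down:
  assumes D: "small_categorder D" and E: "small_categorder E" and G: "is_functorder D E G"
    and A: "A \<subseteq> Mor D"
  shows "down E (onMor G ` down D A) = down E (onMor G ` A)"
proof (intro equalityI subsetI)
  fix f assume "f \<in> down E (onMor G ` down D A)"
  then obtain g h where "le E f (onMor G g)" "le D g h" "h \<in> A"
    by auto
  then show "f \<in> down E (onMor G ` A)"
    using functorder_mono[OF G] scat_trans[OF E] by (blast intro: downI)
next
  fix f assume "f \<in> down E (onMor G ` A)"
  then obtain g where "le E f (onMor G g)" "g \<in> A"
    by auto
  then show "f \<in> down E (onMor G ` down D A)"
    using A scat_refl[OF D] by (blast intro: downI)
qed

lemma down_tset: "small_categorder C \<Longrightarrow> m \<in> P1_Mor C \<Longrightarrow> down C (elts (tset m)) = elts (tset m)"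
  using P1_Mor_down P1_Mor_tset by (fastforce intro: downI scat_refl)

lemma functor_P1: "is_functor (Cat1 :: ('v::universe scat, 'v fo) cat) Cat1 P1_fun"
proof (rule functorI)
  fix C D E :: "'v scat" and m n
  assume "m \<in> hom Cat1 C D" "n \<in> hom Cat1 D E"
  then obtain F G where m: "m = (C, F, D)" "(C, F, D) \<in> Mor Cat1"
    and n: "n = (D, G, E)" "(D, G, E) \<in> Mor Cat1"
    unfolding hom_Cat1 by blast
  then have C: "small_categorder C" and D: "small_categorder D" and E: "small_categorder E"
    and F: "is_functorder C D F" and G: "is_functorder D E G"
    by simp_all
  let ?GF = "\<lparr>onOb = compose (Ob C) (onOb G) (onOb F), onMor = compose (Mor C) (onMor G) (onMor F)\<rparr>"
  have GF: "(C, ?GF, E) \<in> Mor Cat1"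
    using Cat1_Comp_Mor[OF m(2) n(2)] by simp
  let ?H = "\<lparr>onOb = compose (vPow (Ob C)) (onOb (P1_map D G E)) (onOb (P1_map C F D)),
    onMor = compose (P1_Mor C) (onMor (P1_map D G E)) (onMor (P1_map C F D))\<rparr>"
  have H: "(P1_cat C, ?H, P1_cat E) \<in> Mor Cat1"
    using Cat1_Comp_Mor[OF P1_map_Cat1[OF m(2)] P1_map_Cat1[OF n(2)]] by simp
  have ob: "vset (compose (Ob C) (onOb G) (onOb F) ` elts X) = onOb (P1_map D G E) (vset (onOb F ` elts X))"
    if "elts X \<subseteq> Ob C" for X
  proof -
    have "onOb F ` elts X \<subseteq> Ob D"
      using that functorder_Ob[OF F] by blast
    then show ?thesis
      using that by (simp add: compose_def image_restrict_subset image_image cong del: image_cong_simp)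
  qed
  have "(P1_cat C, P1_map C ?GF E, P1_cat E) = (P1_cat C, ?H, P1_cat E)"
  proof (rule Cat1_mor_eqI[OF P1_map_Cat1[OF GF] H])
    fix X assume "X \<in> Ob (P1_cat C)"
    then show "onOb (P1_map C ?GF E) X = onOb ?H X"
      using ob[of X] by (simp add: compose_eq)
  next
    fix k assume "k \<in> Mor (P1_cat C)"
    then have k: "k \<in> P1_Mor C"
      by simp
    then have Fk: "onMor (P1_map C F D) k \<in> P1_Mor D"
      using functorder_Mor[OF functorder_P1_map[OF C D F]] by simp
    have sub: "elts (tset k) \<subseteq> Mor C" "onMor F ` elts (tset k) \<subseteq> Mor D"
      using P1_Mor_tset_subset[OF k] functorder_Mor[OF F] by blast+
    have "down E (onMor ?GF ` elts (tset k)) = down E (onMor G ` onMor F ` elts (tset k))"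
      using sub(1) by (simp add: compose_def image_restrict_subset image_image cong del: image_cong_simp)
    also have "\<dots> = down E (onMor G ` down D (onMor F ` elts (tset k)))"
      by (rule down_image_down[OF D E G sub(2), symmetric])
    finally show "onMor (P1_map C ?GF E) k = onMor ?H k"
      using Fk k D ob[OF P1_Mor_tdom[OF k]] ob[OF P1_Mor_tcod[OF k]]
        P1_Mor_tdom[OF Fk] P1_Mor_tcod[OF Fk] by (simp add: compose_eq)
  qed
  then show "onMor P1_fun (Comp Cat1 n m) = Comp Cat1 (onMor P1_fun n) (onMor P1_fun m)"
    using m n by simp
next
  fix C :: "'v scat" assume "C \<in> Ob Cat1"
  then have C: "small_categorder C"
    by simp
  let ?I = "\<lparr>onOb = \<lambda>a\<in>Ob C. a, onMor = \<lambda>f\<in>Mor C. f\<rparr>"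
  let ?J = "\<lparr>onOb = \<lambda>a\<in>vPow (Ob C). a, onMor = \<lambda>f\<in>P1_Mor C. f\<rparr>"
  have I: "(C, ?I, C) \<in> Mor Cat1"
    using functorder_id[OF C] C by simp
  have J: "(P1_cat C, ?J, P1_cat C) \<in> Mor Cat1"
    using functorder_id[OF small_categorder_P1_cat[OF C]] small_categorder_P1_cat[OF C] by simp
  have "(P1_cat C, P1_map C ?I C, P1_cat C) = (P1_cat C, ?J, P1_cat C)"
  proof (rule Cat1_mor_eqI[OF P1_map_Cat1[OF I] J])
    fix X assume "X \<in> Ob (P1_cat C)"
    then show "onOb (P1_map C ?I C) X = onOb ?J X"
      by (simp add: image_restrict_subset cong del: image_cong_simp)
  next
    fix k assume "k \<in> Mor (P1_cat C)"
    then have k: "k \<in> P1_Mor C"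
      by simp
    with C show "onMor (P1_map C ?I C) k = onMor ?J k"
      by (simp add: image_restrict_subset P1_Mor_tdom P1_Mor_tcod P1_Mor_tset_subset down_tset
          P1_Mor_triple cong del: image_cong_simp)
  qed
  then show "onMor P1_fun (Idn Cat1 C) = Idn Cat1 (onOb P1_fun C)"
    by simp
next
  fix C D :: "'v scat" and m
  assume "m \<in> hom Cat1 C D"
  then obtain F where "m = (C, F, D)" "(C, F, D) \<in> Mor Cat1"
    unfolding hom_Cat1 by blast
  then show "onMor P1_fun m \<in> hom Cat1 (onOb P1_fun C) (onOb P1_fun D)"
    using P1_map_Cat1[of C F D] by (simp add: hom_Cat1)
qed (simp_all add: category_Cat1 small_categorder_P1_cat)

text \<open>This rule and its analogues for unit and multiplication expose only the underlying set.
  In the monad laws the triples can then stay folded, since their ends are determined by the object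
  functions.\<close>

lemma elts_tset_P1_map:
  "small_categorder D \<Longrightarrow> m \<in> P1_Mor C \<Longrightarrow>
    elts (tset (onMor (P1_map C F D) m)) = down D (onMor F ` elts (tset m))"
  by simp

lemma elts_tset_P1_unit:
  "small_categorder C \<Longrightarrow> f \<in> Mor C \<Longrightarrow> elts (tset (onMor (P1_unit C) f)) = down C {f}"
  by simp

lemma elts_tset_P1_mult:
  "m \<in> P1_Mor (P1_cat C) \<Longrightarrow>
    elts (tset (onMor (P1_mult C) m)) = (\<Union>n\<in>elts (tset m). elts (tset n))"
  by simp

section \<open>Unit and multiplication as functorders\<close>

lemma P1_P1_Mor_tset:
  assumes "m \<in> P1_Mor (P1_cat C)" "n \<in> elts (tset m)"
  shows "n \<in> P1_Mor C \<and> tdom n \<in> elts (tdom m) \<and> tcod n \<in> elts (tcod m)"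
  using P1_Mor_tset[OF assms] by auto

lemma functorder_P1_unit:
  assumes C: "small_categorder C"
  shows "is_functorder C (P1_cat C) (P1_unit C)"
proof -
  have mor: "onMor (P1_unit C) f \<in> P1_Mor C" if f: "f \<in> Mor C" for f
    unfolding P1_unit_simps(2)[OF f]
  proof (rule P1_MorI)
    fix g assume "g \<in> elts (vset (down C {f}))"
    then show "g \<in> Mor C \<and> Dom C g \<in> elts (vset {Dom C f}) \<and> Cod C g \<in> elts (vset {Cod C f})"
      using C scat_leD[OF C, of g f] by simp
  next
    fix g h assume "h \<in> elts (vset (down C {f}))" "le C g h"
    then show "g \<in> elts (vset (down C {f}))"
      using C by (simp add: down_closed del: mem_down)
  qed (use C f in simp_all)
  show ?thesis
  proof (rule functorderI)
    fix f assume "f \<in> Mor C"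
    then show "onMor (P1_unit C) f \<in> Mor (P1_cat C) \<and>
        Dom (P1_cat C) (onMor (P1_unit C) f) = onOb (P1_unit C) (Dom C f) \<and>
        Cod (P1_cat C) (onMor (P1_unit C) f) = onOb (P1_unit C) (Cod C f)"
      using mor[of f] C by simp
  next
    fix f g assume le: "le C f g"
    note le' = scat_leD[OF C le]
    have "down C {f} \<subseteq> down C {g}"
      using scat_trans[OF C _ le] by auto
    with le' mor[of f] mor[of g] show "le (P1_cat C) (onMor (P1_unit C) f) (onMor (P1_unit C) g)"
      using C by simp
  next
    fix c assume c: "c \<in> Ob C"
    then show "le (P1_cat C) (onMor (P1_unit C) (Idn C c)) (Idn (P1_cat C) (onOb (P1_unit C) c))"
      using mor[of "Idn C c"] C by simp
  next
    fix f g assume fg: "f \<in> Mor C" "g \<in> Mor C" "Cod C f = Dom C g"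
    \<comment> \<open>The witnesses are \<open>f\<close> and \<open>g\<close> themselves, each in
      its own down closure by reflexivity.\<close>
    have "down C {Comp C g f} \<subseteq> comps C (down C {g}) (down C {f})"
    proof
      fix h assume "h \<in> down C {Comp C g f}"
      then have "le C h (Comp C g f)"
        by simp
      then show "h \<in> comps C (down C {g}) (down C {f})"
        using fg C by (intro compsI[of f _ g]) simp_all
    qed
    moreover have "Comp (P1_cat C) (onMor (P1_unit C) g) (onMor (P1_unit C) f) \<in> P1_Mor C"
      by (rule P1_Comp_closed[OF C mor[OF fg(1)] mor[OF fg(2)]]) (simp add: fg)
    ultimately show "le (P1_cat C) (onMor (P1_unit C) (Comp C g f))
        (Comp (P1_cat C) (onMor (P1_unit C) g) (onMor (P1_unit C) f))"
      using mor[OF fg(1)] mor[OF fg(2)] mor[of "Comp C g f"] fg C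
      by (simp del: mem_comps mem_down)
  qed (use C in simp)
qed

lemma P1_unit_Cat1: "small_categorder C \<Longrightarrow> (C, P1_unit C, P1_cat C) \<in> Mor Cat1"
  by (simp add: functorder_P1_unit small_categorder_P1_cat)

text \<open>A union of down closed sets is down closed, so no closure has to be taken. On composites
  the inclusion can be strict: \<open>p\<close> and \<open>q\<close> with \<open>tcod p\<close>
  different from \<open>tdom q\<close> do not compose in \<open>P1_cat C\<close>, yet elements of
  their underlying sets may compose in \<open>C\<close>.\<close>

lemma functorder_P1_mult:
  assumes C: "small_categorder C"
  shows "is_functorder (P1_cat (P1_cat C)) (P1_cat C) (P1_mult C)"
proof -
  note PC = small_categorder_P1_cat[OF C]
  have ob: "(\<Union>x\<in>elts X. elts x) \<subseteq> Ob C" if "elts X \<subseteq> vPow (Ob C)" for X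
    using that by fastforce
  have tdom: "elts (tdom m) \<subseteq> vPow (Ob C)" and tcod: "elts (tcod m) \<subseteq> vPow (Ob C)"
    if "m \<in> P1_Mor (P1_cat C)" for m
    using P1_Mor_tdom[OF that] P1_Mor_tcod[OF that] by simp_all
  have mor: "onMor (P1_mult C) m \<in> P1_Mor C" if m: "m \<in> P1_Mor (P1_cat C)" for m
    unfolding P1_mult_simps(2)[OF m]
  proof (rule P1_MorI)
    fix f assume "f \<in> elts (vset (\<Union>n\<in>elts (tset m). elts (tset n)))"
    then obtain n where n: "n \<in> elts (tset m)" and f: "f \<in> elts (tset n)"
      by auto
    note n' = P1_P1_Mor_tset[OF m n]
    with P1_Mor_tset[of n C f] f show "f \<in> Mor C \<and>
        Dom C f \<in> elts (vset (\<Union>x\<in>elts (tdom m). elts x)) \<and>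
        Cod C f \<in> elts (vset (\<Union>y\<in>elts (tcod m). elts y))"
      by auto
  next
    fix f g assume "g \<in> elts (vset (\<Union>n\<in>elts (tset m). elts (tset n)))" "le C f g"
    then show "f \<in> elts (vset (\<Union>n\<in>elts (tset m). elts (tset n)))"
      using P1_P1_Mor_tset[OF m] P1_Mor_down[of _ C g f] by auto
  qed (simp_all add: ob[OF tdom[OF m], simplified] ob[OF tcod[OF m], simplified])
  show ?thesis
  proof (rule functorderI)
    fix m assume "m \<in> Mor (P1_cat (P1_cat C))"
    then show "onMor (P1_mult C) m \<in> Mor (P1_cat C) \<and>
        Dom (P1_cat C) (onMor (P1_mult C) m) = onOb (P1_mult C) (Dom (P1_cat (P1_cat C)) m) \<and>
        Cod (P1_cat C) (onMor (P1_mult C) m) = onOb (P1_mult C) (Cod (P1_cat (P1_cat C)) m)"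
      using mor[of m] tdom[of m] tcod[of m] by simp
  next
    fix m n assume "le (P1_cat (P1_cat C)) m n"
    then have mn: "m \<in> P1_Mor (P1_cat C)" "n \<in> P1_Mor (P1_cat C)" "tdom m = tdom n"
      "tcod m = tcod n" "elts (tset m) \<subseteq> elts (tset n)"
      by simp_all
    have "(\<Union>k\<in>elts (tset m). elts (tset k)) \<subseteq> (\<Union>k\<in>elts (tset n). elts (tset k))"
      using mn(5) by blast
    then show "le (P1_cat C) (onMor (P1_mult C) m) (onMor (P1_mult C) n)"
      using mor[OF mn(1)] mor[OF mn(2)] mn by simp
  next
    fix X assume "X \<in> Ob (P1_cat (P1_cat C))"
    then have X: "elts X \<subseteq> vPow (Ob C)"
      by simp
    \<comment> \<open>The name keeps simplification from expanding an identity two levels up; only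
      its ends and its underlying set are used. The composite \<open>k\<close> below is treated
      likewise.\<close>
    define I where "I = Idn (P1_cat (P1_cat C)) X"
    have I: "I \<in> P1_Mor (P1_cat C)" "tdom I = X" "tcod I = X"
      "elts (tset I) = down (P1_cat C) (Idn (P1_cat C) ` elts X)"
      using P1_Idn_in_P1_Mor[OF PC, of X] X PC by (simp_all add: I_def)
    have "(\<Union>n\<in>elts (tset I). elts (tset n)) \<subseteq> down C (Idn C ` (\<Union>x\<in>elts X. elts x))"
    proof
      fix f assume "f \<in> (\<Union>n\<in>elts (tset I). elts (tset n))"
      then obtain n Y where Y: "Y \<in> elts X" and n: "le (P1_cat C) n (Idn (P1_cat C) Y)"
        and f: "f \<in> elts (tset n)"
        unfolding I(4) by auto
      have "elts Y \<subseteq> Ob C"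
        using subsetD[OF X Y] by simp
      \<comment> \<open>Lying below \<open>Idn (P1_cat C) Y\<close> means inclusion of underlying
        sets, and the underlying set of that identity is this down closure.\<close>
      then have "f \<in> down C (Idn C ` elts Y)"
        using n f C by (auto simp del: mem_down)
      then show "f \<in> down C (Idn C ` (\<Union>x\<in>elts X. elts x))"
        using Y by auto
    qed
    then show "le (P1_cat C) (onMor (P1_mult C) (Idn (P1_cat (P1_cat C)) X))
        (Idn (P1_cat C) (onOb (P1_mult C) X))"
      unfolding I_def[symmetric]
      using mor[OF I(1)] I(1-3) X C ob[OF X] P1_Idn_in_P1_Mor[OF C, of "vset (\<Union>x\<in>elts X. elts x)"]
      by (simp del: mem_down)
  next
    fix m n
    assume "m \<in> Mor (P1_cat (P1_cat C))" "n \<in> Mor (P1_cat (P1_cat C))"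
      and "Cod (P1_cat (P1_cat C)) m = Dom (P1_cat (P1_cat C)) n"
    then have m: "m \<in> P1_Mor (P1_cat C)" and n: "n \<in> P1_Mor (P1_cat C)" and eq: "tcod m = tdom n"
      by simp_all
    define k where "k = Comp (P1_cat (P1_cat C)) n m"
    have k: "k \<in> P1_Mor (P1_cat C)" "tdom k = tdom m" "tcod k = tcod n"
      "elts (tset k) = comps (P1_cat C) (elts (tset n)) (elts (tset m))"
      using m n eq PC by (simp_all add: k_def P1_Comp_in_P1_Mor del: mem_comps)
    have "(\<Union>j\<in>elts (tset k). elts (tset j)) \<subseteq>
      comps C (\<Union>j\<in>elts (tset n). elts (tset j)) (\<Union>j\<in>elts (tset m). elts (tset j))"
    proof
      fix h assume "h \<in> (\<Union>j\<in>elts (tset k). elts (tset j))"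
      then obtain j p q where p: "p \<in> elts (tset m)" and q: "q \<in> elts (tset n)"
        and pq: "Cod (P1_cat C) p = Dom (P1_cat C) q"
        and j: "le (P1_cat C) j (Comp (P1_cat C) q p)" and h: "h \<in> elts (tset j)"
        unfolding k(4) by auto
      have "p \<in> P1_Mor C" "q \<in> P1_Mor C"
        using P1_P1_Mor_tset[OF m p] P1_P1_Mor_tset[OF n q] by simp_all
      then have "h \<in> comps C (elts (tset q)) (elts (tset p))"
        using pq j h C by (auto simp del: mem_comps)
      then show "h \<in> comps C (\<Union>j\<in>elts (tset n). elts (tset j)) (\<Union>j\<in>elts (tset m). elts (tset j))"
        using p q comps_mono[of "elts (tset p)" "\<Union>j\<in>elts (tset m). elts (tset j)"
          "elts (tset q)" "\<Union>j\<in>elts (tset n). elts (tset j)" C] by blast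
    qed
    moreover have "Comp (P1_cat C) (onMor (P1_mult C) n) (onMor (P1_mult C) m) \<in> P1_Mor C"
      by (rule P1_Comp_closed[OF C mor[OF m] mor[OF n]]) (simp add: m n eq)
    ultimately show "le (P1_cat C) (onMor (P1_mult C) (Comp (P1_cat (P1_cat C)) n m))
        (Comp (P1_cat C) (onMor (P1_mult C) n) (onMor (P1_mult C) m))"
      unfolding k_def[symmetric]
      using mor[OF m] mor[OF n] mor[OF k(1)] m n eq k(1-3) C
      by (simp del: mem_comps)
  qed (use ob in simp)
qed

lemma P1_mult_Cat1:
  "small_categorder C \<Longrightarrow> (P1_cat (P1_cat C), P1_mult C, P1_cat C) \<in> Mor Cat1"
  by (simp add: functorder_P1_mult small_categorder_P1_cat)

text \<open>A functorder determines the domains and codomains of its values by its object function, so for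
  functorders into a power categorder only the underlying sets of morphisms have to be compared.\<close>

lemma Cat1_P1_eqI:
  assumes F: "(C, F, P1_cat D) \<in> Mor Cat1" and G: "(C, G, P1_cat D) \<in> Mor Cat1"
    and ob: "\<And>a. a \<in> Ob C \<Longrightarrow> onOb F a = onOb G a"
    and mor: "\<And>f. f \<in> Mor C \<Longrightarrow> elts (tset (onMor F f)) = elts (tset (onMor G f))"
  shows "(C, F, P1_cat D) = (C, G, P1_cat D)"
proof (rule Cat1_mor_eqI[OF F G ob])
  fix f assume f: "f \<in> Mor C"
  have C: "small_categorder C" and F': "is_functorder C (P1_cat D) F"
    and G': "is_functorder C (P1_cat D) G"
    using F G by simp_all
  have M: "onMor F f \<in> P1_Mor D" "onMor G f \<in> P1_Mor D"
    using functorder_Mor[OF F' f] functorder_Mor[OF G' f] by simp_all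
  show "onMor F f = onMor G f"
    using functorder_Dom[OF F' f] functorder_Dom[OF G' f] functorder_Cod[OF F' f]
      functorder_Cod[OF G' f] M ob[of "Dom C f"] ob[of "Cod C f"] f C mor[OF f]
    by (intro P1_Mor_eqI[OF M]) simp_all
qed

text \<open>The intermediate categorders \<open>B\<close> and \<open>B'\<close> may differ, as they
  do for the two paths around a naturality square.\<close>

lemma Cat1_Comp_P1_eqI:
  assumes "(C, F, B) \<in> Mor Cat1" "(B, G, P1_cat D) \<in> Mor Cat1"
    and "(C, F', B') \<in> Mor Cat1" "(B', G', P1_cat D) \<in> Mor Cat1"
    and "\<And>a. a \<in> Ob C \<Longrightarrow> onOb G (onOb F a) = onOb G' (onOb F' a)"
    and "\<And>f. f \<in> Mor C \<Longrightarrow>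
      elts (tset (onMor G (onMor F f))) = elts (tset (onMor G' (onMor F' f)))"
  shows "Comp Cat1 (B, G, P1_cat D) (C, F, B) = Comp Cat1 (B', G', P1_cat D) (C, F', B')"
  using Cat1_Comp_Mor[OF assms(1,2)] Cat1_Comp_Mor[OF assms(3,4)] assms(5,6)
  unfolding Cat1_simps(6) by (intro Cat1_P1_eqI) (simp_all only: fmap.simps compose_eq)

text \<open>The counterpart for the unit laws, where one side is an identity and not a
  composite.\<close>

lemma Cat1_Comp_P1_eq_Idn:
  assumes C: "small_categorder C"
    and FG: "(P1_cat C, F, B) \<in> Mor Cat1" "(B, G, P1_cat C) \<in> Mor Cat1"
    and "\<And>X. elts X \<subseteq> Ob C \<Longrightarrow> onOb G (onOb F X) = X"
    and "\<And>m. m \<in> P1_Mor C \<Longrightarrow> elts (tset (onMor G (onMor F m))) = elts (tset m)"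
  shows "Comp Cat1 (B, G, P1_cat C) (P1_cat C, F, B) = Idn Cat1 (P1_cat C)"
proof -
  have "Idn Cat1 (P1_cat C) \<in> Mor Cat1"
    using functorder_id[OF small_categorder_P1_cat[OF C]] small_categorder_P1_cat[OF C] by simp
  then show ?thesis
    using Cat1_Comp_Mor[OF FG] assms(4,5) unfolding Cat1_simps(5,6)
    by (intro Cat1_P1_eqI) (simp_all only: fmap.simps compose_eq restrict_apply' P1_cat_simps mem_vPow)
qed

section \<open>Naturality and the monad laws\<close>

lemma P1_unit_natural:
  assumes F: "(C, F, D) \<in> Mor Cat1"
  shows "Comp Cat1 (D, P1_unit D, P1_cat D) (C, F, D) =
    Comp Cat1 (P1_cat C, P1_map C F D, P1_cat D) (C, P1_unit C, P1_cat C)"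
proof -
  have C: "small_categorder C" and D: "small_categorder D" and F': "is_functorder C D F"
    using F by simp_all
  show ?thesis
  proof (rule Cat1_Comp_P1_eqI[OF F P1_unit_Cat1[OF D] P1_unit_Cat1[OF C] P1_map_Cat1[OF F]])
    fix a assume "a \<in> Ob C"
    then show "onOb (P1_unit D) (onOb F a) = onOb (P1_map C F D) (onOb (P1_unit C) a)"
      using functorder_Ob[OF F'] by simp
  next
    fix f assume f: "f \<in> Mor C"
    then have "onMor (P1_unit C) f \<in> P1_Mor C"
      using functorder_Mor[OF functorder_P1_unit[OF C]] by simp
    \<comment> \<open>Naturality of the unit on morphisms is absorption of the inner closure for a
      singleton.\<close>
    moreover have "down D (onMor F ` down C {f}) = down D {onMor F f}"
      using down_image_down[OF C D F', of "{f}"] f by simp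
    ultimately show "elts (tset (onMor (P1_unit D) (onMor F f))) =
        elts (tset (onMor (P1_map C F D) (onMor (P1_unit C) f)))"
      unfolding elts_tset_P1_unit[OF D functorder_Mor[OF F' f]]
      by (simp only: elts_tset_P1_map[OF D] elts_tset_P1_unit[OF C f])
  qed
qed

text \<open>The closure taken in \<open>P1_cat D\<close> disappears under the union: each morphism
  it adds has its underlying set contained in that of an image already present, and reflexivity
  keeps the images themselves. What remains is that direct image followed by \<open>down D\<close>
  commutes with unions.\<close>

lemma P1_mult_natural:
  assumes F: "(C, F, D) \<in> Mor Cat1"
  shows "Comp Cat1 (P1_cat (P1_cat D), P1_mult D, P1_cat D)
      (P1_cat (P1_cat C), P1_map (P1_cat C) (P1_map C F D) (P1_cat D), P1_cat (P1_cat D)) =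
    Comp Cat1 (P1_cat C, P1_map C F D, P1_cat D) (P1_cat (P1_cat C), P1_mult C, P1_cat C)"
proof -
  have C: "small_categorder C" and D: "small_categorder D" and F': "is_functorder C D F"
    using F by simp_all
  note PC = small_categorder_P1_cat[OF C] and PD = small_categorder_P1_cat[OF D]
    and PF = P1_map_Cat1[OF F] and PF' = functorder_P1_map[OF C D F']
  show ?thesis
  proof (rule Cat1_Comp_P1_eqI[OF P1_map_Cat1[OF PF] P1_mult_Cat1[OF D] P1_mult_Cat1[OF C] PF])
    fix X assume "X \<in> Ob (P1_cat (P1_cat C))"
    then have X: "elts X \<subseteq> vPow (Ob C)"
      by simp
    have img: "onOb (P1_map C F D) ` elts X = (\<lambda>x. vset (onOb F ` elts x)) ` elts X"
      using X by (intro image_cong) auto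
    have "(\<lambda>x. vset (onOb F ` elts x)) ` elts X \<subseteq> vPow (Ob D)"
      using X functorder_Ob[OF F'] by fastforce
    moreover have "(\<Union>x\<in>elts X. elts x) \<subseteq> Ob C"
      using X by fastforce
    ultimately show "onOb (P1_mult D) (onOb (P1_map (P1_cat C) (P1_map C F D) (P1_cat D)) X) =
        onOb (P1_map C F D) (onOb (P1_mult C) X)"
      using X by (simp add: img image_UN)
  next
    fix M assume "M \<in> Mor (P1_cat (P1_cat C))"
    then have M: "M \<in> P1_Mor (P1_cat C)"
      by simp
    have PM: "onMor (P1_map (P1_cat C) (P1_map C F D) (P1_cat D)) M \<in> P1_Mor (P1_cat D)"
      using functorder_Mor[OF functorder_P1_map[OF PC PD PF']] M by simp
    have uM: "onMor (P1_mult C) M \<in> P1_Mor C"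
      using functorder_Mor[OF functorder_P1_mult[OF C]] M by simp
    have Fm: "onMor (P1_map C F D) m \<in> P1_Mor D"
      "elts (tset (onMor (P1_map C F D) m)) = down D (onMor F ` elts (tset m))"
      if "m \<in> elts (tset M)" for m
      using functorder_Mor[OF PF', of m] P1_P1_Mor_tset[OF M that] elts_tset_P1_map[OF D]
      by (simp_all del: P1_map_simps)
    have "(\<Union>n\<in>down (P1_cat D) (onMor (P1_map C F D) ` elts (tset M)). elts (tset n)) =
      down D (onMor F ` (\<Union>m\<in>elts (tset M). elts (tset m)))"
    proof (intro equalityI subsetI)
      fix f assume "f \<in> (\<Union>n\<in>down (P1_cat D) (onMor (P1_map C F D) ` elts (tset M)). elts (tset n))"
      then obtain n m where m: "m \<in> elts (tset M)"
        and n: "le (P1_cat D) n (onMor (P1_map C F D) m)" and f: "f \<in> elts (tset n)"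
        unfolding down_def by blast
      have "f \<in> down D (onMor F ` elts (tset m))"
        using n f Fm(2)[OF m] by (auto simp del: mem_down P1_map_simps)
      then show "f \<in> down D (onMor F ` (\<Union>m\<in>elts (tset M). elts (tset m)))"
        using m by auto
    next
      fix f assume "f \<in> down D (onMor F ` (\<Union>m\<in>elts (tset M). elts (tset m)))"
      then obtain m where m: "m \<in> elts (tset M)" and "f \<in> down D (onMor F ` elts (tset m))"
        by auto
      then have "f \<in> elts (tset (onMor (P1_map C F D) m))"
        using Fm(2)[OF m] by simp
      moreover have "le (P1_cat D) (onMor (P1_map C F D) m) (onMor (P1_map C F D) m)"
        using Fm(1)[OF m] PD by (simp del: P1_map_simps)
      ultimately show "f \<in>
          (\<Union>n\<in>down (P1_cat D) (onMor (P1_map C F D) ` elts (tset M)). elts (tset n))"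
        using m unfolding down_def by blast
    qed
    then show "elts (tset (onMor (P1_mult D)
          (onMor (P1_map (P1_cat C) (P1_map C F D) (P1_cat D)) M))) =
        elts (tset (onMor (P1_map C F D) (onMor (P1_mult C) M)))"
      by (simp only: elts_tset_P1_mult[OF PM] elts_tset_P1_map[OF PD M]
          elts_tset_P1_map[OF D uM] elts_tset_P1_mult[OF M])
  qed
qed

text \<open>A down closed set is the union of the principal down sets \<open>down C {g}\<close> of
  its elements; the additional closure in \<open>P1_cat C\<close> only contributes subsets of
  these.\<close>

lemma P1_mult_P1_unit:
  assumes C: "small_categorder C"
  shows "Comp Cat1 (P1_cat (P1_cat C), P1_mult C, P1_cat C)
      (P1_cat C, P1_map C (P1_unit C) (P1_cat C), P1_cat (P1_cat C)) = Idn Cat1 (P1_cat C)"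
proof -
  note PC = small_categorder_P1_cat[OF C] and u = functorder_P1_unit[OF C]
  show ?thesis
  proof (rule Cat1_Comp_P1_eq_Idn[OF C P1_map_Cat1[OF P1_unit_Cat1[OF C]] P1_mult_Cat1[OF C]])
    fix X assume X: "elts X \<subseteq> Ob C"
    have img: "onOb (P1_unit C) ` elts X = (\<lambda>c. vset {c}) ` elts X"
      using X by (intro image_cong) auto
    have "(\<lambda>c. vset {c}) ` elts X \<subseteq> vPow (Ob C)"
      using X by auto
    then show "onOb (P1_mult C) (onOb (P1_map C (P1_unit C) (P1_cat C)) X) = X"
      using X by (simp add: img)
  next
    fix m assume m: "m \<in> P1_Mor C"
    have Pm: "onMor (P1_map C (P1_unit C) (P1_cat C)) m \<in> P1_Mor (P1_cat C)"
      using functorder_Mor[OF functorder_P1_map[OF C PC u]] m by simp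
    have uf: "onMor (P1_unit C) f \<in> P1_Mor C" "elts (tset (onMor (P1_unit C) f)) = down C {f}"
      if "f \<in> elts (tset m)" for f
      using functorder_Mor[OF u, of f] P1_Mor_tset[OF m that] elts_tset_P1_unit[OF C]
      by (simp_all del: P1_unit_simps)
    have "(\<Union>n\<in>down (P1_cat C) (onMor (P1_unit C) ` elts (tset m)). elts (tset n)) = elts (tset m)"
    proof (intro equalityI subsetI)
      fix f assume "f \<in> (\<Union>n\<in>down (P1_cat C) (onMor (P1_unit C) ` elts (tset m)). elts (tset n))"
      then obtain n g where g: "g \<in> elts (tset m)"
        and n: "le (P1_cat C) n (onMor (P1_unit C) g)" and f: "f \<in> elts (tset n)"
        unfolding down_def by blast
      have "f \<in> down C {g}"
        using n f uf(2)[OF g] by (auto simp del: mem_down P1_unit_simps)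
      then show "f \<in> elts (tset m)"
        using P1_Mor_down[OF m g] by simp
    next
      fix f assume f: "f \<in> elts (tset m)"
      then have "f \<in> elts (tset (onMor (P1_unit C) f))"
        using uf(2)[OF f] P1_Mor_tset[OF m f] C by (simp del: P1_unit_simps)
      moreover have "le (P1_cat C) (onMor (P1_unit C) f) (onMor (P1_unit C) f)"
        using uf(1)[OF f] PC by (simp del: P1_unit_simps)
      ultimately show "f \<in>
          (\<Union>n\<in>down (P1_cat C) (onMor (P1_unit C) ` elts (tset m)). elts (tset n))"
        using f unfolding down_def by blast
    qed
    then show "elts (tset (onMor (P1_mult C) (onMor (P1_map C (P1_unit C) (P1_cat C)) m))) =
        elts (tset m)"
      by (simp only: elts_tset_P1_mult[OF Pm] elts_tset_P1_map[OF PC m])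
  qed
qed

text \<open>The members of \<open>down (P1_cat C) {m}\<close> have underlying sets contained in that
  of \<open>m\<close>, and \<open>m\<close> is one of them, so their union is the underlying set of
  \<open>m\<close>.\<close>

lemma P1_mult_unit_P1:
  assumes C: "small_categorder C"
  shows "Comp Cat1 (P1_cat (P1_cat C), P1_mult C, P1_cat C)
      (P1_cat C, P1_unit (P1_cat C), P1_cat (P1_cat C)) = Idn Cat1 (P1_cat C)"
proof -
  note PC = small_categorder_P1_cat[OF C]
  show ?thesis
  proof (rule Cat1_Comp_P1_eq_Idn[OF C P1_unit_Cat1[OF PC] P1_mult_Cat1[OF C]])
    fix m assume m: "m \<in> P1_Mor C"
    then have m': "m \<in> Mor (P1_cat C)"
      by simp
    have um: "onMor (P1_unit (P1_cat C)) m \<in> P1_Mor (P1_cat C)"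
      using functorder_Mor[OF functorder_P1_unit[OF PC] m'] by simp
    have "(\<Union>n\<in>down (P1_cat C) {m}. elts (tset n)) = elts (tset m)"
      using m by auto
    then show "elts (tset (onMor (P1_mult C) (onMor (P1_unit (P1_cat C)) m))) = elts (tset m)"
      by (simp only: elts_tset_P1_mult[OF um] elts_tset_P1_unit[OF PC m'])
  qed simp
qed

text \<open>Both sides are a double union over the elements of the members of \<open>M\<close>. Only
  the side through \<open>P1_map\<close> takes a down closure, and what it adds lies inside the sets
  \<open>onMor (P1_mult C) m\<close> that are united anyway.\<close>

lemma P1_mult_assoc:
  assumes C: "small_categorder C"
  shows "Comp Cat1 (P1_cat (P1_cat C), P1_mult C, P1_cat C)
      (P1_cat (P1_cat (P1_cat C)), P1_map (P1_cat (P1_cat C)) (P1_mult C) (P1_cat C),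
        P1_cat (P1_cat C)) =
    Comp Cat1 (P1_cat (P1_cat C), P1_mult C, P1_cat C)
      (P1_cat (P1_cat (P1_cat C)), P1_mult (P1_cat C), P1_cat (P1_cat C))"
proof -
  note PC = small_categorder_P1_cat[OF C]
  note PPC = small_categorder_P1_cat[OF PC] and u = functorder_P1_mult[OF C]
  show ?thesis
  proof (rule Cat1_Comp_P1_eqI[OF P1_map_Cat1[OF P1_mult_Cat1[OF C]] P1_mult_Cat1[OF C]
        P1_mult_Cat1[OF PC] P1_mult_Cat1[OF C]])
    fix X assume "X \<in> Ob (P1_cat (P1_cat (P1_cat C)))"
    then have X: "elts X \<subseteq> vPow (vPow (Ob C))"
      by simp
    have img: "onOb (P1_mult C) ` elts X = (\<lambda>Y. vset (\<Union>x\<in>elts Y. elts x)) ` elts X"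
      using X by (intro image_cong) auto
    have "(\<lambda>Y. vset (\<Union>x\<in>elts Y. elts x)) ` elts X \<subseteq> vPow (Ob C)"
      using X by fastforce
    moreover have "(\<Union>Y\<in>elts X. elts Y) \<subseteq> vPow (Ob C)"
      using X by fastforce
    ultimately show "onOb (P1_mult C) (onOb (P1_map (P1_cat (P1_cat C)) (P1_mult C) (P1_cat C)) X) =
        onOb (P1_mult C) (onOb (P1_mult (P1_cat C)) X)"
      using X by (simp add: img)
  next
    fix M assume "M \<in> Mor (P1_cat (P1_cat (P1_cat C)))"
    then have M: "M \<in> P1_Mor (P1_cat (P1_cat C))"
      by simp
    have PM: "onMor (P1_map (P1_cat (P1_cat C)) (P1_mult C) (P1_cat C)) M \<in> P1_Mor (P1_cat C)"
      using functorder_Mor[OF functorder_P1_map[OF PPC PC u]] M by simp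
    have uM: "onMor (P1_mult (P1_cat C)) M \<in> P1_Mor (P1_cat C)"
      using functorder_Mor[OF functorder_P1_mult[OF PC]] M by simp
    have um: "onMor (P1_mult C) m \<in> P1_Mor C"
      "elts (tset (onMor (P1_mult C) m)) = (\<Union>k\<in>elts (tset m). elts (tset k))"
      if "m \<in> elts (tset M)" for m
      using functorder_Mor[OF u, of m] P1_P1_Mor_tset[OF M that] elts_tset_P1_mult[of m C]
      by (simp_all del: P1_mult_simps)
    have "(\<Union>n\<in>down (P1_cat C) (onMor (P1_mult C) ` elts (tset M)). elts (tset n)) =
      (\<Union>n\<in>(\<Union>m\<in>elts (tset M). elts (tset m)). elts (tset n))"
    proof (intro equalityI subsetI)
      fix f assume "f \<in> (\<Union>n\<in>down (P1_cat C) (onMor (P1_mult C) ` elts (tset M)). elts (tset n))"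
      then obtain n m where m: "m \<in> elts (tset M)"
        and n: "le (P1_cat C) n (onMor (P1_mult C) m)" and f: "f \<in> elts (tset n)"
        unfolding down_def by blast
      have "f \<in> elts (tset (onMor (P1_mult C) m))"
        using n f by (auto simp del: P1_mult_simps)
      then show "f \<in> (\<Union>n\<in>(\<Union>m\<in>elts (tset M). elts (tset m)). elts (tset n))"
        using m unfolding um(2)[OF m] by blast
    next
      fix f assume "f \<in> (\<Union>n\<in>(\<Union>m\<in>elts (tset M). elts (tset m)). elts (tset n))"
      then obtain m where m: "m \<in> elts (tset M)" and "f \<in> (\<Union>k\<in>elts (tset m). elts (tset k))"
        by blast
      then have "f \<in> elts (tset (onMor (P1_mult C) m))"
        unfolding um(2)[OF m] by blast
      moreover have "le (P1_cat C) (onMor (P1_mult C) m) (onMor (P1_mult C) m)"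
        using um(1)[OF m] PC by (simp del: P1_mult_simps)
      ultimately show "f \<in>
          (\<Union>n\<in>down (P1_cat C) (onMor (P1_mult C) ` elts (tset M)). elts (tset n))"
        using m unfolding down_def by blast
    qed
    then show "elts (tset (onMor (P1_mult C)
          (onMor (P1_map (P1_cat (P1_cat C)) (P1_mult C) (P1_cat C)) M))) =
        elts (tset (onMor (P1_mult C) (onMor (P1_mult (P1_cat C)) M)))"
      by (simp only: elts_tset_P1_mult[OF PM] elts_tset_P1_map[OF PC M]
          elts_tset_P1_mult[OF uM] elts_tset_P1_mult[OF M])
  qed
qed

lemma monad_P1: "monad (Cat1 :: ('v::universe scat, 'v fo) cat) P1" (is "monad ?C ?P")
  unfolding monad_def
proof (intro conjI ballI)
  show "is_functor ?C ?C (Fun ?P)"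
    by (simp add: functor_P1)
  show "nat_trans ?C ?C idF (Fun ?P) (unit ?P)"
  proof (rule nat_transI)
    fix C assume "C \<in> Ob ?C"
    then show "unit ?P C \<in> hom ?C (onOb idF C) (onOb (Fun ?P) C)"
      using P1_unit_Cat1[of C] by (simp add: hom_def)
  next
    fix C D m assume "m \<in> hom ?C C D"
    then obtain F where m: "m = (C, F, D)" "(C, F, D) \<in> Mor ?C"
      unfolding hom_Cat1 by blast
    show "Comp ?C (unit ?P D) (onMor idF m) = Comp ?C (onMor (Fun ?P) m) (unit ?P C)"
      using P1_unit_natural[OF m(2)] by (simp only: m(1) P1_simps idF_simps)
  qed (simp_all add: functor_P1 functor_idF category_Cat1)
  show "nat_trans ?C ?C (Fun ?P \<circ>F Fun ?P) (Fun ?P) (mult ?P)"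
  proof (rule nat_transI)
    fix C assume "C \<in> Ob ?C"
    then show "mult ?P C \<in> hom ?C (onOb (Fun ?P \<circ>F Fun ?P) C) (onOb (Fun ?P) C)"
      using P1_mult_Cat1[of C] by (simp add: hom_def)
  next
    fix C D m assume "m \<in> hom ?C C D"
    then obtain F where m: "m = (C, F, D)" "(C, F, D) \<in> Mor ?C"
      unfolding hom_Cat1 by blast
    show "Comp ?C (mult ?P D) (onMor (Fun ?P \<circ>F Fun ?P) m) = Comp ?C (onMor (Fun ?P) m) (mult ?P C)"
      using P1_mult_natural[OF m(2)] by (simp only: m(1) P1_simps compF_simps)
  qed (simp_all add: functor_P1 functor_compF[OF functor_P1 functor_P1])
next
  fix C assume "C \<in> Ob ?C"
  then have C: "small_categorder C"
    by simp
  show "vcomp ?C (mult ?P) (Fun ?P \<cdot>L unit ?P) C = Idn ?C (onOb (Fun ?P) C)"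
    using P1_mult_P1_unit[OF C] by (simp only: vcomp_def whisker_left_def P1_simps)
  show "vcomp ?C (mult ?P) (unit ?P \<cdot>R Fun ?P) C = Idn ?C (onOb (Fun ?P) C)"
    using P1_mult_unit_P1[OF C] by (simp only: vcomp_def whisker_right_def P1_simps)
  show "vcomp ?C (mult ?P) (Fun ?P \<cdot>L mult ?P) C = vcomp ?C (mult ?P) (mult ?P \<cdot>R Fun ?P) C"
    using P1_mult_assoc[OF C]
    by (simp only: vcomp_def whisker_left_def whisker_right_def P1_simps)
qed


section \<open>The forgetful functor\<close>

lemma forget_simps [simp]:
  "onOb forget C = Ob C"
  "onMor forget (C, F, D) = (Ob C, onOb F, Ob D)"
  by (simp_all add: forget_def)

lemma small_Ob: "small_categorder C \<Longrightarrow> small (Ob C)"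
  by (simp add: small_categorder_def)

text \<open>The extensionality demanded of arrows in \<open>Cat1\<close> is what puts the object
  function into the function space of \<open>SetCat\<close>, and it makes composition and identities
  agree literally.\<close>

lemma functor_forget: "is_functor (Cat1 :: ('v::universe scat, 'v fo) cat) SetCat forget"
proof (rule functorI)
  fix C D :: "'v scat" and m
  assume "m \<in> hom Cat1 C D"
  then obtain F where "m = (C, F, D)" "(C, F, D) \<in> Mor Cat1"
    unfolding hom_Cat1 by blast
  then show "onMor forget m \<in> hom SetCat (onOb forget C) (onOb forget D)"
    by (auto simp: hom_SetCat small_Ob PiE_def functorder_Ob)
next
  fix C D E :: "'v scat" and m n
  assume "m \<in> hom Cat1 C D" "n \<in> hom Cat1 D E"
  then show "onMor forget (Comp Cat1 n m) = Comp SetCat (onMor forget n) (onMor forget m)"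
    unfolding hom_Cat1 by auto
qed (simp_all add: category_Cat1 category_SetCat small_Ob)

text \<open>Arrows of \<open>SetCat\<close> are compared as HOL functions, so equations of whole
  functions are needed here and not only values on the carrier. The right-hand sides of this and the
  next two lemmas are the maps of \<open>P0\<close> at \<open>Ob C\<close>.\<close>

lemma onOb_P1_map: "onOb (P1_map C F D) = (\<lambda>X\<in>vPow (Ob C). vset (onOb F ` elts X))"
  by (rule extensionalityI[of _ "vPow (Ob C)"]) simp_all

lemma onOb_P1_unit: "onOb (P1_unit C) = (\<lambda>c\<in>Ob C. vset {c})"
  by (rule extensionalityI[of _ "Ob C"]) simp_all

lemma onOb_P1_mult: "onOb (P1_mult C) = (\<lambda>X\<in>vPow (vPow (Ob C)). vset (\<Union>x\<in>elts X. elts x))"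
  by (rule extensionalityI[of _ "vPow (vPow (Ob C))"]) simp_all

lemma nat_trans_sigma:
  "nat_trans (Cat1 :: ('v::universe scat, 'v fo) cat) SetCat (Fun P0 \<circ>F forget) (forget \<circ>F Fun P1) sigma"
proof (rule nat_transI)
  fix C D :: "'v scat" and m
  assume "m \<in> hom Cat1 C D"
  then obtain F where m: "m = (C, F, D)" "(C, F, D) \<in> Mor Cat1"
    unfolding hom_Cat1 by blast
  \<comment> \<open>Needed because \<open>sigma D\<close> is the identity only on
    \<open>vPow (Ob D)\<close> and undefined elsewhere.\<close>
  have "onOb F ` elts X \<subseteq> Ob D" if "elts X \<subseteq> Ob C" for X
    using that m functorder_Ob[of C D F] by auto
  then show "Comp SetCat (sigma D) (onMor (Fun P0 \<circ>F forget) m) =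
      Comp SetCat (onMor (forget \<circ>F Fun P1) m) (sigma C)"
    by (auto simp: m(1) sigma_def onOb_P1_map intro!: compose_cong)
qed (simp_all add: functor_compF[OF functor_forget functor_P0] functor_compF[OF functor_P1 functor_forget]
  sigma_def hom_SetCat small_Ob)

theorem mainTheorem4:
  shows "functor_of_monads (Cat1 :: ('v::universe scat, 'v fo) cat) P1 SetCat P0 forget sigma \<and>
         natural_iso (Cat1 :: ('v scat, 'v fo) cat) SetCat
           (Fun P0 \<circ>F forget) (forget \<circ>F Fun P1) sigma"
proof
  show "functor_of_monads (Cat1 :: ('v scat, 'v fo) cat) P1 SetCat P0 forget sigma"
    unfolding functor_of_monads_def
  proof (intro conjI ballI)
    fix C :: "'v scat" assume C: "C \<in> Ob Cat1"
    show "(forget \<cdot>L unit P1) C = vcomp SetCat sigma (unit P0 \<cdot>R forget) C"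
      by (auto simp: whisker_left_def whisker_right_def vcomp_def sigma_def onOb_P1_unit compose_def
          intro!: restrict_ext)
    \<comment> \<open>The flattened set has to lie in the domain of \<open>sigma C\<close>; beyond
      that, both sides are the same union map composed with identities.\<close>
    have "(\<Union>x\<in>elts X. elts x) \<subseteq> Ob C" if "elts X \<subseteq> vPow (Ob C)" for X
      using that by fastforce
    then show "vcomp SetCat sigma (mult P0 \<cdot>R forget) C =
        vcomp SetCat (forget \<cdot>L mult P1) (vcomp SetCat (sigma \<cdot>R Fun P1) (Fun P0 \<cdot>L sigma)) C"
      by (auto simp: whisker_left_def whisker_right_def vcomp_def sigma_def onOb_P1_mult compose_def
          image_restrict_subset intro!: restrict_ext cong del: image_cong_simp SUP_cong_simp)
  qed (rule monad_P1 monad_P0 functor_forget nat_trans_sigma)+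
  show "natural_iso (Cat1 :: ('v scat, 'v fo) cat) SetCat (Fun P0 \<circ>F forget) (forget \<circ>F Fun P1) sigma"
    unfolding natural_iso_def
  proof (intro conjI ballI)
    fix C :: "'v scat" assume "C \<in> Ob Cat1"
    then have \<sigma>: "sigma C \<in> hom SetCat (vPow (Ob C)) (vPow (Ob C))"
      by (simp add: sigma_def hom_SetCat small_Ob)
    \<comment> \<open>An identity is its own inverse, so \<open>sigma C\<close> is the witness for
      \<open>iso_mor\<close>.\<close>
    moreover have "Comp SetCat (sigma C) (sigma C) = Idn SetCat (vPow (Ob C))"
      by (simp add: sigma_def compose_restrict_id_right)
    moreover have "sigma C \<in> Mor SetCat" "Dom SetCat (sigma C) = vPow (Ob C)"
      "Cod SetCat (sigma C) = vPow (Ob C)"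
      using \<sigma> by (simp_all add: hom_def)
    ultimately show "iso_mor SetCat (sigma C)"
      unfolding iso_mor_def by metis
  qed (rule nat_trans_sigma)
qed

end
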